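(* Assume that $p\ge1$ and let $\varphi:\mathbb{T}=\mathbb{S}^1(\tfrac12)\times\mathbb{S}^1(\tfrac12)\to\mathbb{S}^3(\tfrac1{\sqrt2})\subset\mathbb{R}^4$, $\varphi(\gamma,\vartheta)=\big(\tfrac12\cos\gamma,\tfrac12\sin\gamma,\tfrac12\cos\vartheta,\tfrac12\sin\vartheta\big)$, be the minimal Clifford torus. Then (i) $\mathrm{Index}_{p\text{-harm}}(\varphi)=4$ if $1\le p<4$; (ii) $\mathrm{Index}_{p\text{-harm}}(\varphi)=0$ if $p\ge4$; and (i) $\mathrm{Null}_{p\text{-harm}}(\varphi)=7$ if $1\le p<4$; (ii) $\mathrm{Null}_{p\text{-harm}}(\varphi)=11$ if $p=4$; (iii) $\mathrm{Null}_{p\text{-harm}}(\varphi)=7$ if $p>4$.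
   Context: $\mathbb{S}^n(R)$ is the Euclidean $n$-sphere of radius $R$; $\mathbb{T}$ carries the product metric $\frac14(d\gamma^2+d\vartheta^2)$ in the angular coordinates $\gamma,\vartheta\in[0,2\pi]$. For a smooth map $\phi:M\to N$ with $M$ compact, the $p$-energy is $E_{(p)}(\phi)=\frac1p\int_M|d\phi|^p\,dv_M$ and $p$-harmonic maps are its critical points; any minimal isometric immersion is $p$-harmonic. The Jacobi operator $J^\phi_{(p)}$ is the second-order operator on smooth sections of $\phi^{-1}TN$ representing the Hessian of $E_{(p)}$ at the $p$-harmonic map $\phi$: $\frac{\partial^2}{\partial t\,\partial s}\big|_{(0,0)}E_{(p)}(\phi_{t,s})=\int_M\langle J^\phi_{(p)}(V),W\rangle\,dv_M$ for two-parameter variations with $V=\partial_t\phi_{t,0}|_{t=0}$, $W=\partial_s\phi_{0,s}|_{s=0}$. For the minimal Clifford torus $\varphi$ it is given by $$J_{(p)}(V)=(p-2)2^{\frac{p-4}{2}}\,d^*\big(\langle dV,d\varphi\rangle d\varphi\big)+2^{\frac{p-2}{2}}J(V),\qquad J(V)=\overline\Delta V-4V+2V^\top,$$ where $\langle dV,d\varphi\rangle=\sum_i\langle\nabla^\varphi_{e_i}V,d\varphi(e_i)\rangle$ for a local orthonormal frame $\{e_i\}$, $d^*$ is the formal adjoint of $d=\nabla^\varphi$ on sections, $V^\top$ is the component of $V$ tangent to $\varphi(\mathbb{T})$ and $\overline\Delta=d^*d$ is the rough Laplacian. $\mathrm{Index}_{p\text{-harm}}(\varphi)$ is the sum of the dimensions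 of the eigenspaces of $J^\varphi_{(p)}$ with negative eigenvalue, and $\mathrm{Null}_{p\text{-harm}}(\varphi)=\dim\mathrm{Ker}(J^\varphi_{(p)})$.
   Formalization: The claim that Null equals 7 is stated for 1 < p < 4 instead of 1 ≤ p < 4: at p = 1 it fails, since cos(2γ)X1 + (1/√2)sin(2γ)η (X1 the unit γ-direction, η the unit normal) and its analogues lie in the kernel, giving nullity 11. *)

theory Defs
  imports "HOL-Analysis.Analysis" "HOL-Library.Function_Algebras" "HOL-Library.Extended_Nat"
begin

section \<open>Pointwise real vector space structure on functions\<close>

instantiation "fun" :: (type, real_vector) real_vector
begin

definition scaleR_fun_def: "c *\<^sub>R f = (\<lambda>x. c *\<^sub>R f x)"

instance
  by standard (auto simp: scaleR_fun_def fun_eq_iff scaleR_add_right scaleR_add_left)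

end

text \<open>
  The library's \<open>dim\<close> is \<open>0\<close> on infinite-dimensional spaces; here they get dimension \<open>\<infinity>\<close>.
\<close>

definition edim :: "'a::real_vector set \<Rightarrow> enat" where
  "edim S = (if \<exists>B. finite B \<and> S \<subseteq> span B then enat (dim S) else \<infinity>)"

section \<open>The Clifford torus\<close>

text \<open>
  Maps and tensors on the torus are written in the angular coordinates, i.e. as functions of
  \<open>(\<gamma>, \<vartheta>) \<in> \<real>\<^sup>2\<close> that are \<open>2\<pi>\<close>-periodic in each variable.
\<close>

definition periodic :: "(real \<times> real \<Rightarrow> 'a) \<Rightarrow> bool" where
  "periodic f \<longleftrightarrow> (\<forall>\<gamma> \<theta>. f (\<gamma> + 2 * pi, \<theta>) = f (\<gamma>, \<theta>) \<and> f (\<gamma>, \<theta> + 2 * pi) = f (\<gamma>, \<theta>))"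

primrec Ck :: "nat \<Rightarrow> ('a::real_normed_vector \<Rightarrow> 'b::real_normed_vector) \<Rightarrow> bool" where
  "Ck 0 f \<longleftrightarrow> continuous_on UNIV f"
| "Ck (Suc k) f \<longleftrightarrow> (\<forall>x. f differentiable (at x)) \<and> (\<forall>v. Ck k (\<lambda>x. frechet_derivative f (at x) v))"

definition smooth :: "('a::real_normed_vector \<Rightarrow> 'b::real_normed_vector) \<Rightarrow> bool" where
  "smooth f \<longleftrightarrow> (\<forall>k. Ck k f)"

definition clifford :: "real \<times> real \<Rightarrow> real ^ 4" (\<open>\<phi>\<close>) where
  "\<phi> = (\<lambda>(\<gamma>, \<theta>). vector [cos \<gamma> / 2, sin \<gamma> / 2, cos \<theta> / 2, sin \<theta> / 2])"

definition d\<phi> :: "real \<times> real \<Rightarrow> real \<times> real \<Rightarrow> real ^ 4" where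
  "d\<phi> x u = frechet_derivative \<phi> (at x) u"

text \<open>
  The global frame \<open>2\<partial>\<^sub>\<gamma>, 2\<partial>\<^sub>\<vartheta>\<close> is orthonormal for the metric
  \<open>(d\<gamma>\<^sup>2 + d\<vartheta>\<^sup>2) / 4\<close>, whose volume form is \<open>d\<gamma> d\<vartheta> / 4\<close>.
\<close>

definition frame :: "(real \<times> real) set" where
  "frame = {(2, 0), (0, 2)}"

definition integral_torus :: "(real \<times> real \<Rightarrow> real) \<Rightarrow> real" where
  "integral_torus f = integral (cbox (0, 0) (2 * pi, 2 * pi)) (\<lambda>x. f x / 4)"

section \<open>Sections of the pull-back of the tangent bundle of the sphere\<close>

text \<open>
  The fibre over \<open>x\<close> is the tangent space of the sphere at \<open>\<phi> x\<close>, i.e. the orthogonal complement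
  of \<open>\<phi> x\<close> in \<open>\<real>\<^sup>4\<close>.
\<close>

definition sections :: "(real \<times> real \<Rightarrow> real ^ 4) set" where
  "sections = {V. smooth V \<and> periodic V \<and> (\<forall>x. V x \<bullet> \<phi> x = 0)}"

text \<open>
  The pull-back of the Levi-Civita connection of the sphere: differentiate in \<open>\<real>\<^sup>4\<close>, then project
  orthogonally onto the tangent space of the sphere. A bundle-valued 1-form \<open>\<omega>\<close> takes a point
  and a tangent vector of the torus; \<open>nabla V\<close> is the 1-form \<open>dV\<close>.
\<close>

definition nabla :: "(real \<times> real \<Rightarrow> real ^ 4) \<Rightarrow> real \<times> real \<Rightarrow> real \<times> real \<Rightarrow> real ^ 4" where
  "nabla V x u =
    (let w = frechet_derivative V (at x) u in w - ((w \<bullet> \<phi> x) / (\<phi> x \<bullet> \<phi> x)) *\<^sub>R \<phi> x)"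

definition inner_form ::
    "(real \<times> real \<Rightarrow> real \<times> real \<Rightarrow> real ^ 4) \<Rightarrow> (real \<times> real \<Rightarrow> real \<times> real \<Rightarrow> real ^ 4)
      \<Rightarrow> real \<times> real \<Rightarrow> real" where
  "inner_form \<omega> \<eta> x = (\<Sum>e\<in>frame. \<omega> x e \<bullet> \<eta> x e)"

text \<open>The formal adjoint \<open>d\<^sup>*\<close> of \<open>d = nabla\<close> with respect to the \<open>L\<^sup>2\<close> inner products.\<close>

definition dstar ::
    "(real \<times> real \<Rightarrow> real \<times> real \<Rightarrow> real ^ 4) \<Rightarrow> real \<times> real \<Rightarrow> real ^ 4" where
  "dstar \<omega> = (THE S. S \<in> sections \<and>
    (\<forall>W\<in>sections. integral_torus (\<lambda>x. S x \<bullet> W x) = integral_torus (inner_form \<omega> (nabla W))))"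

definition tangential :: "(real \<times> real \<Rightarrow> real ^ 4) \<Rightarrow> real \<times> real \<Rightarrow> real ^ 4" where
  "tangential V x = (THE w. w \<in> range (d\<phi> x) \<and> (\<forall>u. (V x - w) \<bullet> d\<phi> x u = 0))"

section \<open>The Jacobi operator, index and nullity\<close>

definition rough_laplacian :: "(real \<times> real \<Rightarrow> real ^ 4) \<Rightarrow> real \<times> real \<Rightarrow> real ^ 4" where
  "rough_laplacian V = dstar (nabla V)"

definition jacobi :: "(real \<times> real \<Rightarrow> real ^ 4) \<Rightarrow> real \<times> real \<Rightarrow> real ^ 4" where
  "jacobi V = rough_laplacian V - 4 *\<^sub>R V + 2 *\<^sub>R tangential V"

definition p_jacobi :: "real \<Rightarrow> (real \<times> real \<Rightarrow> real ^ 4) \<Rightarrow> real \<times> real \<Rightarrow> real ^ 4" where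
  "p_jacobi p V =
    ((p - 2) * 2 powr ((p - 4) / 2)) *\<^sub>R dstar (\<lambda>x u. inner_form (nabla V) d\<phi> x *\<^sub>R d\<phi> x u)
    + 2 powr ((p - 2) / 2) *\<^sub>R jacobi V"

definition eigenspace :: "real \<Rightarrow> real \<Rightarrow> (real \<times> real \<Rightarrow> real ^ 4) set" where
  "eigenspace p \<mu> = {V \<in> sections. p_jacobi p V = \<mu> *\<^sub>R V}"

text \<open>
  The sum over all negative eigenvalues is the supremum of its finite partial sums; a real \<open>\<mu>\<close> that
  is not an eigenvalue has eigenspace \<open>{0}\<close> and contributes \<open>0\<close>.
\<close>

definition p_index :: "real \<Rightarrow> enat" where
  "p_index p = (SUP F\<in>{F. finite F \<and> F \<subseteq> {..<0}}. \<Sum>\<mu>\<in>F. edim (eigenspace p \<mu>))"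

definition p_nullity :: "real \<Rightarrow> enat" where
  "p_nullity p = edim {V \<in> sections. p_jacobi p V = 0}"

end

theory Submission
  imports Defs
begin

text \<open>
  In the orthonormal frame \<open>E1, E2, normal\<close> of the pull-back bundle, sections are triples
  \<open>(a, b, c)\<close> of smooth doubly periodic functions, and the Jacobi operator becomes a differential
  operator with constant coefficients. On the Fourier mode \<open>(m, n)\<close> it is a Hermitian
  \<open>3 \<times> 3\<close> matrix. This matrix is positive definite for \<open>m\<^sup>2 + n\<^sup>2 \<ge> 4\<close> (only semidefinite if \<open>p = 1\<close>),
  it vanishes on the mode \<open>(0, 0)\<close> and has a one-dimensional kernel and no negative eigenvalue on the four
  modes with \<open>m\<^sup>2 + n\<^sup>2 = 2\<close>, which gives the nullity \<open>3 + 4\<close>. On the four modes with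
  \<open>m\<^sup>2 + n\<^sup>2 = 1\<close> the lowest eigenvalue is simple, with the sign of \<open>p - 4\<close>. As a continuous
  periodic function is determined by its Fourier coefficients (Stone--Weierstrass), these modes
  account for all the eigensections with a nonpositive eigenvalue.
\<close>

section \<open>Smooth functions\<close>

text \<open>The coefficients are constant because the rotations of the two coordinate planes of R^4
  are isometries of the sphere that act transitively on the torus and preserve the frame. The seven
  kernel directions present for every \<open>p\<close> have geometric sources. Six come from
  infinitesimal rotations of R^4: constant \<open>a\<close>, constant \<open>b\<close>, and the four
  real dimensions on the modes with m^2 + n^2 = 2. The seventh, constant \<open>c\<close>, moves the
  torus through its parallel tori with radii r1, r2, along which the density |d\<phi>|^2 = 4 (r1^2 +
  r2^2) = 2 does not change. With k = (p - 2) / 2, the threshold \<open>p = 4\<close> is where the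
  determinant (1 + k) - 2 of a 2 x 2 block on the mode (1, 0) changes sign. The value
  \<open>p = 1\<close> is a genuine obstacle for the nullity: there the modes (2, 0), (-2, 0), (0,
  2), (0, -2) also meet the kernel. Negative eigenvalues are not affected, so the index is computed
  for all p \<ge> 1 but the nullity only for p > 1.\<close>

abbreviation D :: "'a::real_normed_vector \<Rightarrow> ('a \<Rightarrow> 'b::real_normed_vector) \<Rightarrow> 'a \<Rightarrow> 'b" where
  "D v f \<equiv> (\<lambda>x. frechet_derivative f (at x) v)"

lemma D_eqI: "(f has_derivative f') (at x) \<Longrightarrow> D v f x = f' v"
  by (simp add: frechet_derivative_at[symmetric])

lemma Ck_mono: "Ck (Suc k) f \<Longrightarrow> Ck k f"
proof (induction k arbitrary: f)
  case 0
  then show ?case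
    by (auto intro!: differentiable_imp_continuous_on simp: differentiable_on_def)
next
  case (Suc k)
  have "Ck k (D v f)" for v
    by (rule Suc.IH) (use Suc.prems in simp)
  then show ?case using Suc.prems by simp
qed

lemma Ck_const: "Ck k (\<lambda>x. c)"
  by (induction k arbitrary: c) auto

text \<open>This rule and \<open>Ck_SucD\<close> convert between \<open>frechet_derivative\<close>
  and \<open>has_derivative\<close>, so that each closure property becomes an induction driven by
  the corresponding derivative rule.\<close>

lemma Ck_SucI:
  assumes "\<And>x. (f has_derivative (\<lambda>v. f' v x)) (at x)" "\<And>v. Ck k (f' v)"
  shows "Ck (Suc k) f"
proof -
  have "D v f = f' v" for v
    using assms(1) by (intro ext D_eqI)
  moreover have "f differentiable (at x)" for x
    using assms(1) unfolding differentiable_def by blast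
  ultimately show ?thesis
    using assms(2) by simp
qed

lemma Ck_SucD:
  assumes "Ck (Suc k) f"
  shows "(f has_derivative (\<lambda>v. D v f x)) (at x)" "Ck k (D v f)"
  using assms by (simp_all only: Ck.simps frechet_derivative_works simp_thms)

lemma Ck_bounded_linear:
  assumes h: "bounded_linear h" and "Ck k f"
  shows "Ck k (\<lambda>x. h (f x))"
  using assms(2)
proof (induction k arbitrary: f)
  case 0
  then show ?case using h by (auto intro: bounded_linear.continuous_on)
next
  case (Suc k)
  note f = Ck_SucD[OF Suc.prems]
  show ?case
    by (rule Ck_SucI[OF bounded_linear.has_derivative[OF h f(1)] Suc.IH[OF f(2)]])
qed

lemma Ck_add:
  assumes "Ck k f" "Ck k g" shows "Ck k (\<lambda>x. f x + g x)"
  using assms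
proof (induction k arbitrary: f g)
  case 0
  then show ?case by (auto intro: continuous_on_add)
next
  case (Suc k)
  note f = Ck_SucD[OF Suc.prems(1)] and g = Ck_SucD[OF Suc.prems(2)]
  show ?case
    by (rule Ck_SucI[OF has_derivative_add[OF f(1) g(1)] Suc.IH[OF f(2) g(2)]])
qed

lemma Ck_bounded_bilinear:
  assumes b: "bounded_bilinear b" and "Ck k f" "Ck k g"
  shows "Ck k (\<lambda>x. b (f x) (g x))"
  using assms(2,3)
proof (induction k arbitrary: f g)
  case 0
  then show ?case using b by (auto intro: bounded_bilinear.continuous_on)
next
  case (Suc k)
  note f = Ck_SucD[OF Suc.prems(1)] and g = Ck_SucD[OF Suc.prems(2)]
  show ?case
    by (rule Ck_SucI[OF bounded_bilinear.FDERIV[OF b f(1) g(1)]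
          Ck_add[OF Suc.IH[OF Ck_mono[OF Suc.prems(1)] g(2)] Suc.IH[OF f(2) Ck_mono[OF Suc.prems(2)]]]])
qed

text \<open>The factor \<open>c\<close> must vary in the induction: the derivative in direction
  \<open>v\<close> is again a constant, \<open>c * h v * \<i>\<close>, times
  \<open>cis (h x)\<close>.\<close>

lemma Ck_cis:
  fixes h :: "'a::real_normed_vector \<Rightarrow> real"
  assumes h: "bounded_linear h"
  shows "Ck k (\<lambda>x. c * cis (h x))"
proof (induction k arbitrary: c)
  case 0
  then show ?case
    using bounded_linear.continuous_on[OF h continuous_on_id]
    by (auto intro!: continuous_intros)
next
  case (Suc k)
  have der: "((\<lambda>x. c * cis (h x)) has_derivative (\<lambda>v. c * (h v *\<^sub>R (\<i> * cis (h x))))) (at x)" for x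
  proof -
    have e: "((\<lambda>x. exp (\<i> * of_real (h x))) has_derivative
        (\<lambda>v. exp (\<i> * of_real (h x)) * (\<i> * of_real (h v)))) (at x)"
      by (rule has_derivative_compose[of "\<lambda>x. \<i> * of_real (h x)" _ x UNIV exp])
        (auto intro!: derivative_eq_intros bounded_linear_imp_has_derivative[OF h]
          simp: has_field_derivative_def[symmetric] mult.commute)
    show ?thesis
      unfolding cis_conv_exp by (auto intro!: derivative_eq_intros e simp: fun_eq_iff scaleR_conv_of_real)
  qed
  then have "((\<lambda>x. c * cis (h x)) has_derivative (\<lambda>v. (c * h v * \<i>) * cis (h x))) (at x)" for x
    by (simp add: scaleR_conv_of_real mult.assoc)
  then show ?case
    by (rule Ck_SucI) (rule Suc)
qed

lemma smooth_const [simp]: "smooth (\<lambda>x. c)"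
  by (simp add: smooth_def Ck_const)

lemma smooth_bounded_linear: "bounded_linear h \<Longrightarrow> smooth f \<Longrightarrow> smooth (\<lambda>x. h (f x))"
  by (simp add: smooth_def Ck_bounded_linear)

lemma smooth_bounded_bilinear:
  "bounded_bilinear b \<Longrightarrow> smooth f \<Longrightarrow> smooth g \<Longrightarrow> smooth (\<lambda>x. b (f x) (g x))"
  by (simp add: smooth_def Ck_bounded_bilinear)

lemma smooth_add: "smooth f \<Longrightarrow> smooth g \<Longrightarrow> smooth (\<lambda>x. f x + g x)"
  by (simp add: smooth_def Ck_add)

lemmas smooth_minus = smooth_bounded_linear[OF bounded_linear_minus[OF bounded_linear_ident]]
lemmas smooth_scaleR = smooth_bounded_bilinear[OF bounded_bilinear_scaleR]
lemmas smooth_mult = smooth_bounded_bilinear[OF bounded_bilinear_mult]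
lemmas smooth_inner = smooth_bounded_bilinear[OF bounded_bilinear_inner]
lemmas smooth_Re = smooth_bounded_linear[OF bounded_linear_Re]
lemmas smooth_of_real = smooth_bounded_linear[OF bounded_linear_of_real]

lemma smooth_diff: "smooth f \<Longrightarrow> smooth g \<Longrightarrow> smooth (\<lambda>x. f x - g x)"
  using smooth_add[OF _ smooth_minus, of f g] by simp

lemma smooth_cis: "bounded_linear h \<Longrightarrow> smooth (\<lambda>x. cis (h x))"
  using Ck_cis[of h _ 1] by (simp add: smooth_def)

lemma smooth_cos:
  fixes h :: "'a::real_normed_vector \<Rightarrow> real"
  shows "bounded_linear h \<Longrightarrow> smooth (\<lambda>x. cos (h x))"
  using smooth_Re[OF smooth_cis[of h]] by simp

lemma smooth_sin:
  fixes h :: "'a::real_normed_vector \<Rightarrow> real"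
  shows "bounded_linear h \<Longrightarrow> smooth (\<lambda>x. sin (h x))"
  using smooth_bounded_linear[OF bounded_linear_Im smooth_cis[of h]] by simp

lemmas smooth_intros = smooth_const smooth_add smooth_diff smooth_minus smooth_scaleR smooth_mult
  smooth_inner smooth_of_real smooth_Re smooth_cos smooth_sin smooth_cis bounded_linear_fst
  bounded_linear_snd

lemma smooth_differentiable: "smooth f \<Longrightarrow> f differentiable (at x)"
  unfolding smooth_def by (drule spec[of _ "Suc 0"]) simp

lemma smooth_has_derivative: "smooth f \<Longrightarrow> (f has_derivative (\<lambda>v. D v f x)) (at x)"
  by (drule smooth_differentiable) (simp only: frechet_derivative_works)

lemma smooth_D: "smooth f \<Longrightarrow> smooth (D v f)"
  unfolding smooth_def
proof
  show "Ck k (D v f)" if "\<forall>k. Ck k f" for k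
    using that[rule_format, of "Suc k"] by simp
qed

lemma smooth_continuous: "smooth f \<Longrightarrow> continuous_on S f"
  unfolding smooth_def by (drule spec[of _ 0]) (auto intro: continuous_on_subset)

section \<open>Calculation rules for directional derivatives\<close>

lemma D_add: "smooth f \<Longrightarrow> smooth g \<Longrightarrow> D v (\<lambda>x. f x + g x) = (\<lambda>x. D v f x + D v g x)"
  by (rule ext, rule D_eqI) (auto intro!: derivative_eq_intros smooth_has_derivative)

lemma D_diff: "smooth f \<Longrightarrow> smooth g \<Longrightarrow> D v (\<lambda>x. f x - g x) = (\<lambda>x. D v f x - D v g x)"
  by (rule ext, rule D_eqI) (auto intro!: derivative_eq_intros smooth_has_derivative)

lemma D_bounded_linear:
  assumes "bounded_linear h" "smooth f"
  shows "D v (\<lambda>x. h (f x)) = (\<lambda>x. h (D v f x))"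
  by (intro ext D_eqI[OF bounded_linear.has_derivative[OF assms(1) smooth_has_derivative[OF assms(2)]]])

lemma D_bounded_bilinear:
  assumes "bounded_bilinear b" "smooth f" "smooth g"
  shows "D v (\<lambda>x. b (f x) (g x)) = (\<lambda>x. b (f x) (D v g x) + b (D v f x) (g x))"
  by (intro ext D_eqI[OF bounded_bilinear.FDERIV[OF assms(1)
          smooth_has_derivative[OF assms(2)] smooth_has_derivative[OF assms(3)]]])

lemmas D_mult = D_bounded_bilinear[OF bounded_bilinear_mult]
lemmas D_inner = D_bounded_bilinear[OF bounded_bilinear_inner]

section \<open>Periodic functions\<close>

lemma periodic_D:
  fixes f :: "real \<times> real \<Rightarrow> 'b::real_normed_vector"
  assumes "periodic f" "smooth f" shows "periodic (D v f)"
proof -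
  have shift: "D v f (x + c) = D v f x" if "\<And>x. f (x + c) = f x" for x c
  proof -
    have "((\<lambda>y. f (y + c)) has_derivative (\<lambda>v. D v f (x + c))) (at x)"
      by (rule has_derivative_compose[OF _ smooth_has_derivative[OF assms(2)], where f="\<lambda>y. y + c"])
        (auto intro!: derivative_eq_intros)
    then have "D v (\<lambda>y. f (y + c)) x = D v f (x + c)"
      by (rule D_eqI)
    then show ?thesis using that by simp
  qed
  show ?thesis
    using assms(1) shift[of "(2 * pi, 0)"] shift[of "(0, 2 * pi)"] by (auto simp: periodic_def)
qed

lemma periodic_cis:
  "periodic (\<lambda>x. cis (of_int m * fst x + of_int n * snd x))"
proof -
  have "cis (of_int k * (2 * pi)) = 1" for k
    using cis_multiple_2pi[of "of_int k"] by (simp add: mult.commute mult.left_commute)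
  then show ?thesis
    unfolding periodic_def by (simp add: distrib_left cis_mult[symmetric])
qed

text \<open>Integration by parts on the torus has no boundary terms. The orthogonality of the
  exponentials, the Fourier coefficients of derivatives and the formula for \<open>dstar\<close> all
  rest on this.\<close>

lemma integral_D_periodic:
  fixes g :: "real \<times> real \<Rightarrow> 'b::banach"
  assumes g: "periodic g" "smooth g"
  shows "integral (cbox (0, 0) (2 * pi, 2 * pi)) (D v g) = 0"
proof -
  let ?B = "cbox (0, 0) (2 * pi, 2 * pi) :: (real \<times> real) set"
  have c: "continuous_on S (D u g)" for u S
    by (intro smooth_continuous smooth_D g)
  have periodicD: "g (2 * pi, t) = g (0, t)" "g (s, 2 * pi) = g (s, 0)" for s t
    using g(1)[unfolded periodic_def, rule_format, of 0] g(1)[unfolded periodic_def, rule_format, of s 0]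
    by simp_all
  have 1: "integral {0..2 * pi} (\<lambda>s. D (1, 0) g (s, t)) = 0" for t
  proof (rule integral_unique)
    have "((\<lambda>s. g (s, t)) has_vector_derivative D (1, 0) g (s, t)) (at s within {0..2 * pi})" for s
    proof -
      have "((\<lambda>s. g (s, t)) has_derivative (\<lambda>h. D (h, 0) g (s, t))) (at s within {0..2 * pi})"
        by (rule has_derivative_compose[OF _ smooth_has_derivative[OF g(2)], where f="\<lambda>s. (s, t)"])
          (auto intro!: derivative_eq_intros)
      moreover have "(\<lambda>h. D (h, 0) g (s, t)) = (\<lambda>h. h *\<^sub>R D (1, 0) g (s, t))"
      proof
        show "D (h, 0) g (s, t) = h *\<^sub>R D (1, 0) g (s, t)" for h
          using linear_scale[OF has_derivative_linear[OF smooth_has_derivative[OF g(2)]], of "(s, t)" h "(1, 0)"]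
          by simp
      qed
      ultimately show ?thesis by (simp only: has_vector_derivative_def)
    qed
    from fundamental_theorem_of_calculus[OF _ this]
    show "((\<lambda>s. D (1, 0) g (s, t)) has_integral 0) {0..2 * pi}"
      using periodicD by simp
  qed
  have 2: "integral {0..2 * pi} (\<lambda>t. D (0, 1) g (s, t)) = 0" for s
  proof (rule integral_unique)
    have "((\<lambda>t. g (s, t)) has_vector_derivative D (0, 1) g (s, t)) (at t within {0..2 * pi})" for t
    proof -
      have "((\<lambda>t. g (s, t)) has_derivative (\<lambda>h. D (0, h) g (s, t))) (at t within {0..2 * pi})"
        by (rule has_derivative_compose[OF _ smooth_has_derivative[OF g(2)], where f="\<lambda>t. (s, t)"])
          (auto intro!: derivative_eq_intros)
      moreover have "(\<lambda>h. D (0, h) g (s, t)) = (\<lambda>h. h *\<^sub>R D (0, 1) g (s, t))"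
      proof
        show "D (0, h) g (s, t) = h *\<^sub>R D (0, 1) g (s, t)" for h
          using linear_scale[OF has_derivative_linear[OF smooth_has_derivative[OF g(2)]], of "(s, t)" h "(0, 1)"]
          by simp
      qed
      ultimately show ?thesis by (simp only: has_vector_derivative_def)
    qed
    from fundamental_theorem_of_calculus[OF _ this]
    show "((\<lambda>t. D (0, 1) g (s, t)) has_integral 0) {0..2 * pi}"
      using periodicD by simp
  qed
  \<comment> \<open>The iterated integral has the second variable innermost, so this direction needs
    the order of integration swapped before the fundamental theorem of calculus applies.\<close>
  have "integral ?B (D (1, 0) g) = 0"
    using 1 integral_prod_continuous[of 0 0 "2 * pi" "2 * pi" "D (1, 0) g"]
      integral_swap_continuous[of 0 0 "2 * pi" "2 * pi" "\<lambda>s t. D (1, 0) g (s, t)"] c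
    by simp
  moreover have "integral ?B (D (0, 1) g) = 0"
    using 2 integral_prod_continuous[of 0 0 "2 * pi" "2 * pi" "D (0, 1) g"] c
    by simp
  moreover have "D v g = (\<lambda>x. fst v *\<^sub>R D (1, 0) g x + snd v *\<^sub>R D (0, 1) g x)"
  proof
    fix x
    note lin = has_derivative_linear[OF smooth_has_derivative[OF g(2), of x]]
    show "D v g x = fst v *\<^sub>R D (1, 0) g x + snd v *\<^sub>R D (0, 1) g x"
      using linear_add[OF lin, of "(fst v, 0)" "(0, snd v)"] linear_scale[OF lin, of "fst v" "(1, 0)"]
        linear_scale[OF lin, of "snd v" "(0, 1)"] by simp
  qed
  ultimately show ?thesis
    using integrable_continuous[OF c] by (simp add: integral_add integrable_cmul)
qed

section \<open>Fourier coefficients on the torus\<close>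

abbreviation square :: "(real \<times> real) set" where
  "square \<equiv> cbox (0, 0) (2 * pi, 2 * pi)"

definition exp_mode :: "int \<Rightarrow> int \<Rightarrow> real \<times> real \<Rightarrow> complex" where
  "exp_mode m n x = cis (of_int m * fst x + of_int n * snd x)"

definition fourier :: "(real \<times> real \<Rightarrow> real) \<Rightarrow> int \<Rightarrow> int \<Rightarrow> complex" where
  "fourier f m n = integral square (\<lambda>x. of_real (f x) * exp_mode (- m) (- n) x) / (4 * pi\<^sup>2)"

lemma smooth_exp_mode: "smooth (exp_mode m n)"
proof -
  have "bounded_linear (\<lambda>x::real \<times> real. of_int m * fst x + of_int n * snd x)"
    by (intro bounded_linear_add bounded_linear_const_mult bounded_linear_fst bounded_linear_snd)
  then show ?thesis unfolding exp_mode_def[abs_def] by (rule smooth_cis)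
qed

lemma periodic_exp_mode: "periodic (exp_mode m n)"
  unfolding exp_mode_def[abs_def] by (rule periodic_cis)

lemma exp_mode_mult: "exp_mode m n x * exp_mode m' n' x = exp_mode (m + m') (n + n') x"
  by (simp add: exp_mode_def cis_mult algebra_simps)

lemma exp_mode_0 [simp]: "exp_mode 0 0 x = 1"
  by (simp add: exp_mode_def)

lemma cnj_exp_mode: "cnj (exp_mode m n x) = exp_mode (- m) (- n) x"
  by (simp add: exp_mode_def cis_cnj)

lemma D_exp_mode:
  "D v (exp_mode m n) = (\<lambda>x. \<i> * of_real (of_int m * fst v + of_int n * snd v) * exp_mode m n x)"
proof
  fix x
  have e: "((\<lambda>x::real \<times> real. exp (\<i> * of_real (of_int m * fst x + of_int n * snd x))) has_derivative
      (\<lambda>v. exp (\<i> * of_real (of_int m * fst x + of_int n * snd x)) * (\<i> * of_real (of_int m * fst v + of_int n * snd v)))) (at x)"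
    by (rule has_derivative_compose[of "\<lambda>x. \<i> * of_real (of_int m * fst x + of_int n * snd x)" _ x UNIV exp])
      (auto intro!: derivative_eq_intros simp: has_field_derivative_def[symmetric] mult.commute)
  then show "D v (exp_mode m n) x = \<i> * of_real (of_int m * fst v + of_int n * snd v) * exp_mode m n x"
    unfolding exp_mode_def[abs_def] cis_conv_exp by (subst D_eqI[OF e]) (simp add: mult.commute)
qed

text \<open>A partial derivative of \<open>exp_mode m n\<close> is \<i> * m or \<i> * n times itself
  and integrates to 0, so the integral vanishes unless both indices do.\<close>

lemma integral_exp_mode:
  "integral square (exp_mode m n) = (if m = 0 \<and> n = 0 then 4 * pi\<^sup>2 else 0)"
proof -
  have 1: "of_int m * integral square (exp_mode m n) = 0"
    using integral_D_periodic[OF periodic_exp_mode smooth_exp_mode, where v = "(1, 0)", of m n]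
    by (simp add: D_exp_mode)
  have 2: "of_int n * integral square (exp_mode m n) = 0"
    using integral_D_periodic[OF periodic_exp_mode smooth_exp_mode, where v = "(0, 1)", of m n]
    by (simp add: D_exp_mode)
  have "exp_mode 0 0 = (\<lambda>x. 1)" by (simp add: fun_eq_iff)
  then have 3: "integral square (exp_mode 0 0) = 4 * pi\<^sup>2"
    by (simp add: content_Pair power2_eq_square scaleR_conv_of_real)
  show ?thesis
    using 1 2 3 by auto
qed

lemma integrable_exp_mode:
  "continuous_on square f \<Longrightarrow> (\<lambda>x. of_real (f x) * exp_mode m n x) integrable_on square"
  by (intro integrable_continuous continuous_on_mult continuous_on_of_real
      smooth_continuous[OF smooth_exp_mode])

lemma fourier_add:
  assumes "continuous_on square f" "continuous_on square g"
  shows "fourier (\<lambda>x. f x + g x) m n = fourier f m n + fourier g m n"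
  unfolding fourier_def
  by (simp add: ring_distribs integral_add integrable_exp_mode assms add_divide_distrib)

lemma fourier_cmult: "fourier (\<lambda>x. c * f x) m n = c * fourier f m n"
  unfolding fourier_def by (simp add: mult.assoc)

lemma fourier_minus: "fourier (\<lambda>x. - f x) m n = - fourier f m n"
  using fourier_cmult[of "-1"] by simp

lemma fourier_diff:
  assumes "continuous_on square f" "continuous_on square g"
  shows "fourier (\<lambda>x. f x - g x) m n = fourier f m n - fourier g m n"
  using fourier_add[of f "\<lambda>x. - g x"] assms by (simp add: fourier_minus continuous_on_minus)

lemma fourier_cnj: "fourier f (- m) (- n) = cnj (fourier f m n)"
  unfolding fourier_def
  by (simp add: integral_cnj cnj_exp_mode)

text \<open>Integration by parts: the derivative of the product of \<open>f\<close> with the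
  conjugate exponential integrates to 0.\<close>

lemma fourier_D:
  assumes "smooth f" "periodic f"
  shows "fourier (D v f) m n = \<i> * of_real (of_int m * fst v + of_int n * snd v) * fourier f m n"
proof -
  let ?e = "exp_mode (- m) (- n)"
  let ?h = "\<lambda>x. complex_of_real (f x) * ?e x"
  have h: "smooth ?h" "periodic ?h"
    using assms smooth_exp_mode periodic_exp_mode[of "- m" "- n"]
    by (auto intro!: smooth_intros simp: periodic_def)
  have c: "continuous_on square f" "continuous_on square (D v f)"
    using assms smooth_D smooth_continuous by blast+
  have "D v ?h = (\<lambda>x. of_real (D v f x) * ?e x
      - \<i> * of_real (of_int m * fst v + of_int n * snd v) * (of_real (f x) * ?e x))"
    unfolding D_mult[OF smooth_of_real[OF assms(1)] smooth_exp_mode]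
      D_bounded_linear[OF bounded_linear_of_real assms(1), THEN fun_cong] D_exp_mode[THEN fun_cong]
    by (simp add: algebra_simps)
  then have "integral square (\<lambda>x. of_real (D v f x) * ?e x)
      = \<i> * of_real (of_int m * fst v + of_int n * snd v) * integral square (\<lambda>x. of_real (f x) * ?e x)"
    using integral_D_periodic[OF h(2,1), of v]
    by (simp add: integral_diff integrable_exp_mode c integrable_on_mult_right)
  then show ?thesis unfolding fourier_def by simp
qed

section \<open>Uniqueness of Fourier coefficients\<close>

lemma periodic_shift:
  assumes "periodic f"
  shows "f (s + 2 * pi * of_int k, t + 2 * pi * of_int l) = f (s, t)"
proof -
  have 1: "f (s + 2 * pi * of_nat k, t) = f (s, t)" for s t k
  proof (induction k)
    case (Suc k)
    then show ?case
      using assms[unfolded periodic_def, rule_format, of "s + 2 * pi * of_nat k" t]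
      by (simp add: algebra_simps)
  qed simp
  have 2: "f (s, t + 2 * pi * of_nat k) = f (s, t)" for s t k
  proof (induction k)
    case (Suc k)
    then show ?case
      using assms[unfolded periodic_def, rule_format, of s "t + 2 * pi * of_nat k"]
      by (simp add: algebra_simps)
  qed simp
  have 3: "f (s + 2 * pi * of_int k, t) = f (s, t)" for s t k
    using 1[of s "nat k" t] 1[of "s + 2 * pi * of_int k" "nat (- k)" t] by (cases "k \<ge> 0") auto
  have 4: "f (s, t + 2 * pi * of_int k) = f (s, t)" for s t k
    using 2[of s t "nat k"] 2[of s "t + 2 * pi * of_int k" "nat (- k)"] by (cases "k \<ge> 0") auto
  show ?thesis using 3 4 by simp
qed

section \<open>The embedding as a compact model of the quotient torus\<close>

lemma vector_4 [simp]:
  "(vector [a, b, c, d] :: 'a::zero ^ 4) $ 1 = a" "(vector [a, b, c, d] :: 'a ^ 4) $ 2 = b"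
  "(vector [a, b, c, d] :: 'a ^ 4) $ 3 = c" "(vector [a, b, c, d] :: 'a ^ 4) $ 4 = d"
  unfolding vector_def by simp_all

lemma clifford_nth [simp]:
  "\<phi> x $ 1 = cos (fst x) / 2" "\<phi> x $ 2 = sin (fst x) / 2"
  "\<phi> x $ 3 = cos (snd x) / 2" "\<phi> x $ 4 = sin (snd x) / 2"
  by (simp_all add: clifford_def case_prod_beta vector_4)

text \<open>Written with constant vectors, the map is accessible to the smoothness and derivative
  rules for sums and scalar multiples; the \<open>_alt\<close> forms of the frame vectors serve the
  same end.\<close>

lemma clifford_alt: "\<phi> x = (cos (fst x) / 2) *\<^sub>R axis 1 1 + (sin (fst x) / 2) *\<^sub>R axis 2 1
    + (cos (snd x) / 2) *\<^sub>R axis 3 1 + (sin (snd x) / 2) *\<^sub>R axis 4 1"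
  by (simp add: vec_eq_iff forall_4 axis_def)

lemma smooth_clifford: "smooth \<phi>"
  unfolding clifford_alt[abs_def] divide_inverse by (intro smooth_intros)

text \<open>Equal cosines and sines force the angles to agree modulo 2 pi. So \<phi> identifies the
  torus with a compact subset of R^4, where polynomials approximate continuous functions.\<close>

lemma periodic_factors_through_clifford:
  fixes f :: "real \<times> real \<Rightarrow> 'a"
  assumes "periodic f" "\<phi> x = \<phi> y"
  shows "f x = f y"
proof -
  have "cos (fst x) = cos (fst y)" "sin (fst x) = sin (fst y)"
    "cos (snd x) = cos (snd y)" "sin (snd x) = sin (snd y)"
    using assms(2) clifford_nth[of x] clifford_nth[of y] by auto
  then obtain k l :: int where "fst x = fst y + 2 * pi * k" "snd x = snd y + 2 * pi * l"
    using sin_cos_eq_iff by metis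
  then show ?thesis using periodic_shift[OF assms(1), of "fst y" k "snd y" l] by (metis prod.collapse)
qed

lemma reduce_to_square: "\<exists>y\<in>square. \<phi> y = \<phi> x"
proof -
  have *: "\<exists>r\<in>{0..2 * pi}. cos r = cos s \<and> sin r = sin s" for s :: real
  proof -
    have "\<exists>r. 0 \<le> r \<and> r < 2 * pi \<and> cos s = cos r \<and> sin s = sin r"
      by (rule sincos_total_2pi[of "cos s" "sin s"]) auto
    then show ?thesis by force
  qed
  obtain r t where "r \<in> {0..2 * pi}" "cos r = cos (fst x)" "sin r = sin (fst x)"
      "t \<in> {0..2 * pi}" "cos t = cos (snd x)" "sin t = sin (snd x)"
    using * by metis
  then show ?thesis by (intro bexI[of _ "(r, t)"]) (auto simp: clifford_def case_prod_beta)
qed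

lemma continuous_factor_clifford:
  fixes f :: "real \<times> real \<Rightarrow> real"
  assumes f: "continuous_on UNIV f" "periodic f"
  obtains g where "continuous_on (\<phi> ` square) g" "\<And>x. f x = g (\<phi> x)"
proof -
  define g where "g = (\<lambda>y. f (SOME x. \<phi> x = y))"
  have g: "f x = g (\<phi> x)" for x
    unfolding g_def by (rule periodic_factors_through_clifford[OF f(2)]) (metis (mono_tags) someI)
  have "closedin (top_of_set (\<phi> ` square)) (\<phi> ` square \<inter> g -` C)" if "closed C" for C
  proof -
    have "\<phi> ` square \<inter> g -` C = \<phi> ` (square \<inter> f -` C)"
      using g by auto
    moreover have "compact (\<phi> ` (square \<inter> f -` C))"
      using f(1) that
      by (intro compact_continuous_image smooth_continuous[OF smooth_clifford] compact_Int_closed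
          compact_cbox closed_vimage) (auto simp: continuous_on_eq_continuous_at)
    ultimately show ?thesis
      by (metis closed_subset compact_imp_closed inf_le1)
  qed
  then have "continuous_on (\<phi> ` square) g"
    by (simp add: continuous_closedin_preimage_eq)
  then show thesis using that g by blast
qed

text \<open>
  On the image of \<open>\<phi>\<close> the coordinates are cosines and sines, and multiplying by one of
  them only shifts the indices of the Fourier coefficients.
\<close>

lemma fourier_zero_mult_polynomial:
  assumes "real_polynomial_function P"
    and "continuous_on UNIV f" "\<And>m n. fourier f m n = 0"
  shows "continuous_on UNIV (\<lambda>x. f x * P (\<phi> x)) \<and> (\<forall>m n. fourier (\<lambda>x. f x * P (\<phi> x)) m n = 0)"
  using assms
proof (induction arbitrary: f)
  case (linear h)
  have c: "continuous_on S f" for S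
    using linear.prems(1) continuous_on_subset by blast
  \<comment> \<open>Multiplication by a cosine averages the coefficients at the two indices shifted
    by (k, l) and its negative. Only (1, 0) and (0, 1) are needed, for the coordinates of
    \<phi>.\<close>
  have cosine: "fourier (\<lambda>x. c * (f x * cos (of_int k * fst x + of_int l * snd x))) m n = 0" for c k l m n
  proof -
    have "of_real (f x * cos (of_int k * fst x + of_int l * snd x)) * exp_mode (- m) (- n) x =
        (of_real (f x) * exp_mode (- (m - k)) (- (n - l)) x + of_real (f x) * exp_mode (- (m + k)) (- (n + l)) x) / 2" for x
      by (simp add: exp_mode_def complex_eq_iff cos_add sin_add cos_diff sin_diff algebra_simps)
    then have "fourier (\<lambda>x. f x * cos (of_int k * fst x + of_int l * snd x)) m n
        = (fourier f (m - k) (n - l) + fourier f (m + k) (n + l)) / 2"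
      unfolding fourier_def
      by (simp add: integral_add integrable_exp_mode c add_divide_distrib)
    then show ?thesis using linear.prems(2) fourier_cmult by simp
  qed
  have sine: "fourier (\<lambda>x. c * (f x * sin (of_int k * fst x + of_int l * snd x))) m n = 0" for c k l m n
  proof -
    have "of_real (f x * sin (of_int k * fst x + of_int l * snd x)) * exp_mode (- m) (- n) x =
        (of_real (f x) * exp_mode (- (m - k)) (- (n - l)) x - of_real (f x) * exp_mode (- (m + k)) (- (n + l)) x) / (2 * \<i>)" for x
      by (simp add: exp_mode_def complex_eq_iff Re_divide Im_divide cos_add sin_add cos_diff sin_diff algebra_simps)
    then have "fourier (\<lambda>x. f x * sin (of_int k * fst x + of_int l * snd x)) m n
        = (fourier f (m - k) (n - l) - fourier f (m + k) (n + l)) / (2 * \<i>)"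
      unfolding fourier_def
      by (simp add: integral_diff integrable_exp_mode c) (simp add: diff_divide_distrib right_diff_distrib)
    then show ?thesis using linear.prems(2) fourier_cmult by simp
  qed
  have eq: "(\<lambda>x. f x * h (\<phi> x)) = (\<lambda>x. h (axis 1 1) / 2 * (f x * cos (fst x)) + h (axis 2 1) / 2 * (f x * sin (fst x))
      + h (axis 3 1) / 2 * (f x * cos (snd x)) + h (axis 4 1) / 2 * (f x * sin (snd x)))"
    using linear.hyps[THEN bounded_linear.linear]
    by (simp add: fun_eq_iff clifford_alt linear_add linear_scale algebra_simps)
  have coeffs: "fourier (\<lambda>x. c * (f x * cos (fst x))) m n = 0" "fourier (\<lambda>x. c * (f x * sin (fst x))) m n = 0"
    "fourier (\<lambda>x. c * (f x * cos (snd x))) m n = 0" "fourier (\<lambda>x. c * (f x * sin (snd x))) m n = 0" for c m n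
    using cosine[of c 1 0] sine[of c 1 0] cosine[of c 0 1] sine[of c 0 1] by simp_all
  have cont: "continuous_on square (\<lambda>x. c * (f x * cos (fst x)))" "continuous_on square (\<lambda>x. c * (f x * sin (fst x)))"
    "continuous_on square (\<lambda>x. c * (f x * cos (snd x)))" "continuous_on square (\<lambda>x. c * (f x * sin (snd x)))" for c
    by (intro continuous_intros c)+
  have "continuous_on UNIV (\<lambda>x. f x * h (\<phi> x))"
    using linear.prems(1) bounded_linear.continuous_on[OF linear.hyps smooth_continuous[OF smooth_clifford]]
    by (intro continuous_on_mult)
  moreover have "fourier (\<lambda>x. f x * h (\<phi> x)) m n = 0" for m n
    unfolding eq by (simp only: fourier_add continuous_on_add cont coeffs add_0)
  ultimately show ?case by blast
next
  case (const c)
  then show ?case using fourier_cmult[of c f] by (auto simp: mult.commute intro!: continuous_intros)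
next
  case (add P Q)
  note P = add.IH(1)[OF add.prems] and Q = add.IH(2)[OF add.prems]
  have "continuous_on square (\<lambda>x. f x * P (\<phi> x))" "continuous_on square (\<lambda>x. f x * Q (\<phi> x))"
    using P Q continuous_on_subset by blast+
  then show ?case
    using P Q by (simp add: distrib_left fourier_add continuous_on_add)
next
  \<comment> \<open>The induction hypothesis for \<open>Q\<close> is applied to \<open>f\<close>
    times \<open>P\<close> composed with \<phi>; hence the induction with \<open>f\<close>
    arbitrary.\<close>
  case (mult P Q)
  then show ?case by (simp add: mult.assoc[symmetric])
qed

text \<open>The coefficient at (0, 0) of f * P shows that \<open>f\<close> is orthogonal to every
  polynomial \<open>P\<close> in \<phi>. If \<open>P\<close> approximates \<open>f\<close> within
  \<open>e\<close>, the integral of f^2 equals that of f * (f - P), which is at most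
  \<open>e\<close> times the integral of the absolute value of \<open>f\<close>.\<close>

lemma fourier_unique:
  assumes f: "continuous_on UNIV f" "periodic f" and 0: "\<And>m n. fourier f m n = 0"
  shows "f = (\<lambda>x. 0)"
proof -
  have c: "continuous_on square f"
    using f(1) continuous_on_subset by blast
  obtain g where g: "continuous_on (\<phi> ` square) g" "\<And>x. f x = g (\<phi> x)"
    using continuous_factor_clifford[OF f] by blast
  have T: "compact (\<phi> ` square)"
    by (intro compact_continuous_image smooth_continuous smooth_clifford compact_cbox)
  have "integral square (\<lambda>x. f x * f x) \<le> e * integral square (\<lambda>x. \<bar>f x\<bar>)" if e: "e > 0" for e
  proof -
    obtain P where P: "polynomial_function P" "\<And>x. x \<in> \<phi> ` square \<Longrightarrow> norm (g x - P x) < e"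
      using Stone_Weierstrass_polynomial_function[OF T g(1) e] by blast
    have P': "real_polynomial_function P"
      using P(1) by (simp add: real_polynomial_function_eq)
    note Z = fourier_zero_mult_polynomial[OF P' f(1) 0]
    have cP: "continuous_on square (\<lambda>x. f x * P (\<phi> x))"
      using Z continuous_on_subset by blast
    have "integral square (\<lambda>x. complex_of_real (f x * P (\<phi> x))) = 0"
      using Z[THEN conjunct2, rule_format, of 0 0] by (simp add: fourier_def)
    then have "integral square (\<lambda>x. f x * P (\<phi> x)) = 0"
      using integral_linear[OF integrable_continuous[OF cP] bounded_linear_of_real[where 'a=complex]]
      by (simp add: o_def)
    then have "integral square (\<lambda>x. f x * f x) = integral square (\<lambda>x. f x * f x - f x * P (\<phi> x))"
      by (subst integral_diff) (auto intro!: integrable_continuous continuous_intros c cP)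
    also have "\<dots> \<le> integral square (\<lambda>x. e * \<bar>f x\<bar>)"
    proof (rule integral_le)
      fix x assume "x \<in> square"
      then have "\<bar>f x - P (\<phi> x)\<bar> \<le> e"
        using P(2)[of "\<phi> x"] g(2)[of x] by force
      then have "\<bar>f x\<bar> * \<bar>f x - P (\<phi> x)\<bar> \<le> \<bar>f x\<bar> * e"
        by (rule mult_left_mono) simp
      moreover have "f x * f x - f x * P (\<phi> x) \<le> \<bar>f x\<bar> * \<bar>f x - P (\<phi> x)\<bar>"
        unfolding abs_mult[symmetric] right_diff_distrib[symmetric] by (rule abs_ge_self)
      ultimately show "f x * f x - f x * P (\<phi> x) \<le> e * \<bar>f x\<bar>"
        by (simp only: mult.commute[of e])
    qed (auto intro!: integrable_continuous continuous_intros c cP)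
    finally show ?thesis by simp
  qed
  note bound = this
  have "integral square (\<lambda>x. f x * f x) \<le> 0"
  proof (rule field_le_epsilon)
    fix e :: real assume e: "e > 0"
    define I where "I = integral square (\<lambda>x. \<bar>f x\<bar>)"
    have I: "I \<ge> 0"
      unfolding I_def by (rule integral_nonneg) (auto intro!: integrable_continuous continuous_intros c)
    \<comment> \<open>The summand 1 keeps the denominator positive when \<open>I\<close> is
      0.\<close>
    have "integral square (\<lambda>x. f x * f x) \<le> e / (I + 1) * I"
      unfolding I_def by (rule bound) (use e I in \<open>simp add: I_def\<close>)
    also have "\<dots> \<le> e" using e I by (simp add: field_simps)
    finally show "integral square (\<lambda>x. f x * f x) \<le> 0 + e" by simp
  qed
  moreover have "integral square (\<lambda>x. f x * f x) \<ge> 0"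
    by (rule integral_nonneg) (auto intro!: integrable_continuous continuous_intros c)
  ultimately have "\<forall>x\<in>square. f x * f x = 0"
    by (subst integral_cbox_eq_0_iff[symmetric])
      (auto intro!: continuous_intros c simp: box_ne_empty Basis_prod_def)
  then have "f x = 0" for x
    using reduce_to_square[of x] periodic_factors_through_clifford[OF f(2)] by (metis mult_eq_0_iff)
  then show ?thesis by blast
qed

section \<open>An orthonormal frame of the pull-back bundle\<close>

definition E1 :: "real \<times> real \<Rightarrow> real ^ 4" where
  "E1 x = vector [- sin (fst x), cos (fst x), 0, 0]"

definition E2 :: "real \<times> real \<Rightarrow> real ^ 4" where
  "E2 x = vector [0, 0, - sin (snd x), cos (snd x)]"

definition normal :: "real \<times> real \<Rightarrow> real ^ 4" where
  "normal x = (1 / sqrt 2) *\<^sub>R vector [cos (fst x), sin (fst x), - cos (snd x), - sin (snd x)]"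

definition comb ::
    "(real \<times> real \<Rightarrow> real) \<Rightarrow> (real \<times> real \<Rightarrow> real) \<Rightarrow> (real \<times> real \<Rightarrow> real) \<Rightarrow> real \<times> real \<Rightarrow> real ^ 4" where
  "comb a b c x = a x *\<^sub>R E1 x + b x *\<^sub>R E2 x + c x *\<^sub>R normal x"

lemma E1_alt: "E1 x = (- sin (fst x)) *\<^sub>R axis 1 1 + cos (fst x) *\<^sub>R axis 2 1"
  by (simp add: E1_def vec_eq_iff forall_4 axis_def)

lemma E2_alt: "E2 x = (- sin (snd x)) *\<^sub>R axis 3 1 + cos (snd x) *\<^sub>R axis 4 1"
  by (simp add: E2_def vec_eq_iff forall_4 axis_def)

lemma normal_alt: "normal x = (1 / sqrt 2) *\<^sub>R (cos (fst x) *\<^sub>R axis 1 1 + sin (fst x) *\<^sub>R axis 2 1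
    - cos (snd x) *\<^sub>R axis 3 1 - sin (snd x) *\<^sub>R axis 4 1)"
  by (simp add: normal_def vec_eq_iff forall_4 axis_def)

lemma smooth_frame: "smooth E1" "smooth E2" "smooth normal"
  unfolding E1_alt[abs_def] E2_alt[abs_def] normal_alt[abs_def] by (intro smooth_intros)+

lemma periodic_frame: "periodic E1" "periodic E2" "periodic normal"
  by (simp_all add: periodic_def E1_def E2_def normal_def)

lemma inner_frame [simp]:
  "E1 x \<bullet> E1 x = 1" "E2 x \<bullet> E2 x = 1" "normal x \<bullet> normal x = 1"
  "E1 x \<bullet> E2 x = 0" "E1 x \<bullet> normal x = 0" "E2 x \<bullet> normal x = 0"
  "E2 x \<bullet> E1 x = 0" "normal x \<bullet> E1 x = 0" "normal x \<bullet> E2 x = 0"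
  "E1 x \<bullet> \<phi> x = 0" "E2 x \<bullet> \<phi> x = 0" "normal x \<bullet> \<phi> x = 0" "\<phi> x \<bullet> \<phi> x = 1 / 2"
proof -
  have n: "vector [cos (fst x), sin (fst x), - cos (snd x), - sin (snd x)]
      \<bullet> (vector [cos (fst x), sin (fst x), - cos (snd x), - sin (snd x)] :: real ^ 4) = 2"
    using sin_cos_squared_add3[of "fst x"] sin_cos_squared_add3[of "snd x"]
    by (simp add: inner_vec_def sum_4)
  have n': "vector [cos (fst x), sin (fst x), - cos (snd x), - sin (snd x)] \<bullet> \<phi> x
      = (cos (fst x) * cos (fst x) + sin (fst x) * sin (fst x)) / 2
        - (cos (snd x) * cos (snd x) + sin (snd x) * sin (snd x)) / 2"
    by (simp add: inner_vec_def sum_4 field_simps del: sin_cos_squared_add3)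
  show "normal x \<bullet> normal x = 1" "normal x \<bullet> \<phi> x = 0"
    unfolding normal_def inner_scaleR_left inner_scaleR_right n n' by simp_all
qed (use sin_cos_squared_add3[of "fst x"] sin_cos_squared_add3[of "snd x"] in
  \<open>auto simp: E1_def E2_def normal_def inner_vec_def sum_4 field_simps\<close>)

lemma frame_expansion:
  assumes "v \<bullet> \<phi> x = 0"
  shows "v = (v \<bullet> E1 x) *\<^sub>R E1 x + (v \<bullet> E2 x) *\<^sub>R E2 x + (v \<bullet> normal x) *\<^sub>R normal x"
proof -
  define c1 s1 c2 s2 where "c1 = cos (fst x)" "s1 = sin (fst x)" "c2 = cos (snd x)" "s2 = sin (snd x)"
  have t: "c1 * c1 + s1 * s1 = 1" "c2 * c2 + s2 * s2 = 1"
    by (simp_all add: c1_s1_c2_s2_def)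
  have o: "v $ 1 * c1 + v $ 2 * s1 + v $ 3 * c2 + v $ 4 * s2 = 0"
    using assms by (simp add: inner_vec_def sum_4 c1_s1_c2_s2_def)
  have "(v \<bullet> normal x) *\<^sub>R normal x
      = ((v $ 1 * c1 + v $ 2 * s1 - v $ 3 * c2 - v $ 4 * s2) / 2) *\<^sub>R vector [c1, s1, - c2, - s2]"
  proof -
    have w: "v \<bullet> vector [c1, s1, - c2, - s2] = v $ 1 * c1 + v $ 2 * s1 - v $ 3 * c2 - v $ 4 * s2"
      by (simp add: inner_vec_def sum_4)
    show ?thesis
      unfolding normal_def c1_s1_c2_s2_def[symmetric] inner_scaleR_right w by simp
  qed
  \<comment> \<open>By \<open>o\<close> the radial parts of \<open>v\<close> in the two planes are
    opposite, so half their difference is the first of them and minus the second.\<close>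
  also have "\<dots> = vector [(v $ 1 * c1 + v $ 2 * s1) * c1, (v $ 1 * c1 + v $ 2 * s1) * s1,
      (v $ 3 * c2 + v $ 4 * s2) * c2, (v $ 3 * c2 + v $ 4 * s2) * s2]"
    using o by (simp add: vec_eq_iff forall_4) (intro conjI; algebra)
  finally have n: "(v \<bullet> normal x) *\<^sub>R normal x = \<dots>" .
  show ?thesis
    unfolding n using t
    by (simp add: E1_def E2_def inner_vec_def sum_4 vec_eq_iff forall_4 flip: c1_s1_c2_s2_def)
      (intro conjI; algebra)
qed

text \<open>The radial unit vectors of the two planes are \<phi> plus or minus \<open>normal\<close>
  divided by sqrt 2. Since the unit vectors of the torus have coordinates (2, 0) and (0, 2), the
  last two components encode principal curvatures of absolute value sqrt 2 and opposite
  signs.\<close>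

lemma D_frame:
  "D u E1 x = - fst u *\<^sub>R (\<phi> x + (1 / sqrt 2) *\<^sub>R normal x)"
  "D u E2 x = - snd u *\<^sub>R (\<phi> x - (1 / sqrt 2) *\<^sub>R normal x)"
  "D u normal x = (1 / sqrt 2) *\<^sub>R (fst u *\<^sub>R E1 x - snd u *\<^sub>R E2 x)"
  "d\<phi> x u = (1 / 2) *\<^sub>R (fst u *\<^sub>R E1 x + snd u *\<^sub>R E2 x)"
proof -
  have "(E1 has_derivative (\<lambda>u. - fst u *\<^sub>R (\<phi> x + (1 / sqrt 2) *\<^sub>R normal x))) (at x)"
    unfolding E1_alt[abs_def] clifford_alt normal_alt
    by (auto intro!: derivative_eq_intros simp: fun_eq_iff vec_eq_iff forall_4 axis_def field_simps)
  then show "D u E1 x = - fst u *\<^sub>R (\<phi> x + (1 / sqrt 2) *\<^sub>R normal x)" by (rule D_eqI)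
  have "(E2 has_derivative (\<lambda>u. - snd u *\<^sub>R (\<phi> x - (1 / sqrt 2) *\<^sub>R normal x))) (at x)"
    unfolding E2_alt[abs_def] clifford_alt normal_alt
    by (auto intro!: derivative_eq_intros simp: fun_eq_iff vec_eq_iff forall_4 axis_def field_simps)
  then show "D u E2 x = - snd u *\<^sub>R (\<phi> x - (1 / sqrt 2) *\<^sub>R normal x)" by (rule D_eqI)
  have "(normal has_derivative (\<lambda>u. (1 / sqrt 2) *\<^sub>R (fst u *\<^sub>R E1 x - snd u *\<^sub>R E2 x))) (at x)"
    unfolding E1_alt E2_alt normal_alt[abs_def]
    by (auto intro!: derivative_eq_intros simp: fun_eq_iff vec_eq_iff forall_4 axis_def field_simps)
  then show "D u normal x = (1 / sqrt 2) *\<^sub>R (fst u *\<^sub>R E1 x - snd u *\<^sub>R E2 x)" by (rule D_eqI)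
  have "(\<phi> has_derivative (\<lambda>u. (1 / 2) *\<^sub>R (fst u *\<^sub>R E1 x + snd u *\<^sub>R E2 x))) (at x)"
    unfolding E1_alt E2_alt clifford_alt[abs_def]
    by (auto intro!: derivative_eq_intros simp: fun_eq_iff vec_eq_iff forall_4 axis_def field_simps)
  then show "d\<phi> x u = (1 / 2) *\<^sub>R (fst u *\<^sub>R E1 x + snd u *\<^sub>R E2 x)"
    unfolding d\<phi>_def by (rule D_eqI)
qed

section \<open>Sections as triples of coefficient functions\<close>

definition smooth_periodic :: "(real \<times> real \<Rightarrow> 'b::real_normed_vector) \<Rightarrow> bool" where
  "smooth_periodic f \<longleftrightarrow> smooth f \<and> periodic f"

lemma smooth_periodic_intros:
  fixes f g :: "real \<times> real \<Rightarrow> real"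
  shows "smooth_periodic (\<lambda>x. k)"
    "smooth_periodic f \<Longrightarrow> smooth_periodic g \<Longrightarrow> smooth_periodic (\<lambda>x. f x + g x)"
    "smooth_periodic f \<Longrightarrow> smooth_periodic g \<Longrightarrow> smooth_periodic (\<lambda>x. f x - g x)"
    "smooth_periodic f \<Longrightarrow> smooth_periodic (\<lambda>x. - f x)"
    "smooth_periodic f \<Longrightarrow> smooth_periodic (\<lambda>x. k * f x)"
    "smooth_periodic f \<Longrightarrow> smooth_periodic (D v f)"
  by (auto simp: smooth_periodic_def periodic_def smooth_D intro!: smooth_intros
      periodic_D[unfolded periodic_def, rule_format, THEN conjunct1]
      periodic_D[unfolded periodic_def, rule_format, THEN conjunct2])

lemma comb_inner:
  "comb a b c x \<bullet> E1 x = a x" "comb a b c x \<bullet> E2 x = b x" "comb a b c x \<bullet> normal x = c x"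
  "comb a b c x \<bullet> \<phi> x = 0"
  by (simp_all add: comb_def inner_add_left)

lemma comb_eq_iff: "comb a b c = comb a' b' c' \<longleftrightarrow> a = a' \<and> b = b' \<and> c = c'"
  by (metis comb_inner(1-3) ext)

lemma comb_algebra:
  "comb a b c + comb a' b' c' = comb (\<lambda>x. a x + a' x) (\<lambda>x. b x + b' x) (\<lambda>x. c x + c' x)"
  "comb a b c - comb a' b' c' = comb (\<lambda>x. a x - a' x) (\<lambda>x. b x - b' x) (\<lambda>x. c x - c' x)"
  "s *\<^sub>R comb a b c = comb (\<lambda>x. s * a x) (\<lambda>x. s * b x) (\<lambda>x. s * c x)"
  "0 = comb (\<lambda>x. 0) (\<lambda>x. 0) (\<lambda>x. 0)"
  by (simp_all add: fun_eq_iff comb_def scaleR_fun_def algebra_simps)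

lemma sectionsD:
  assumes "V \<in> sections"
  shows "smooth V" "periodic V" "V x \<bullet> \<phi> x = 0"
  using assms unfolding sections_def by blast+

lemma comb_section:
  assumes "smooth_periodic a" "smooth_periodic b" "smooth_periodic c"
  shows "comb a b c \<in> sections"
proof -
  have eq: "comb a b c = (\<lambda>x. a x *\<^sub>R E1 x + b x *\<^sub>R E2 x + c x *\<^sub>R normal x)"
    by (rule ext) (rule comb_def)
  have "smooth (comb a b c)"
    using assms unfolding eq smooth_periodic_def by (intro smooth_intros smooth_frame) auto
  moreover have "periodic (comb a b c)"
    using assms periodic_frame by (simp add: smooth_periodic_def periodic_def comb_def)
  ultimately show ?thesis
    by (simp add: sections_def comb_inner)
qed

lemma section_combE:
  assumes "V \<in> sections"
  obtains a b c where "smooth_periodic a" "smooth_periodic b" "smooth_periodic c" "V = comb a b c"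
proof
  note V = sectionsD[OF assms]
  show "smooth_periodic (\<lambda>x. V x \<bullet> E1 x)" "smooth_periodic (\<lambda>x. V x \<bullet> E2 x)"
    "smooth_periodic (\<lambda>x. V x \<bullet> normal x)"
    using V(2) periodic_frame
    by (auto simp: smooth_periodic_def periodic_def intro!: smooth_inner V(1) smooth_frame)
  show "V = comb (\<lambda>x. V x \<bullet> E1 x) (\<lambda>x. V x \<bullet> E2 x) (\<lambda>x. V x \<bullet> normal x)"
    using frame_expansion[OF V(3)] by (auto simp: comb_def)
qed

text \<open>\<open>E1\<close> and \<open>E2\<close> are parallel on the flat torus and do not mix;
  the only coupling, through the second fundamental form, is with the normal component.\<close>

lemma nabla_comb:
  assumes "smooth_periodic a" "smooth_periodic b" "smooth_periodic c"
  shows "nabla (comb a b c) x u = comb (\<lambda>x. D u a x + fst u / sqrt 2 * c x)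
    (\<lambda>x. D u b x - snd u / sqrt 2 * c x)
    (\<lambda>x. D u c x - fst u / sqrt 2 * a x + snd u / sqrt 2 * b x) x"
proof -
  have s: "smooth a" "smooth b" "smooth c"
    using assms by (auto simp: smooth_periodic_def)
  have "D u (comb a b c) x = D u (\<lambda>x. a x *\<^sub>R E1 x + b x *\<^sub>R E2 x + c x *\<^sub>R normal x) x"
    by (simp add: comb_def[abs_def])
  also have "\<dots> = a x *\<^sub>R D u E1 x + D u a x *\<^sub>R E1 x + (b x *\<^sub>R D u E2 x + D u b x *\<^sub>R E2 x)
      + (c x *\<^sub>R D u normal x + D u c x *\<^sub>R normal x)"
    by (rule D_eqI[where f' = "\<lambda>u. a x *\<^sub>R D u E1 x + D u a x *\<^sub>R E1 x + (b x *\<^sub>R D u E2 x + D u b x *\<^sub>R E2 x)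
      + (c x *\<^sub>R D u normal x + D u c x *\<^sub>R normal x)"])
      (intro has_derivative_add has_derivative_scaleR smooth_has_derivative s smooth_frame)
  \<comment> \<open>The \<phi> component is isolated because it is exactly what the projection in
    \<open>nabla\<close> removes.\<close>
  finally have w: "D u (comb a b c) x = (- fst u * a x - snd u * b x) *\<^sub>R \<phi> x
      + comb (\<lambda>x. D u a x + fst u / sqrt 2 * c x) (\<lambda>x. D u b x - snd u / sqrt 2 * c x)
        (\<lambda>x. D u c x - fst u / sqrt 2 * a x + snd u / sqrt 2 * b x) x"
    unfolding D_frame comb_def by (simp add: algebra_simps)
  show ?thesis
    unfolding nabla_def Let_def w by (simp add: inner_add_left comb_inner)
qed

lemma nabla_section:
  assumes "V \<in> sections" shows "(\<lambda>x. nabla V x u) \<in> sections"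
proof -
  obtain a b c where abc: "smooth_periodic a" "smooth_periodic b" "smooth_periodic c" "V = comb a b c"
    using section_combE[OF assms] .
  show ?thesis
    unfolding abc(4) nabla_comb[OF abc(1-3)]
    by (rule comb_section) (intro smooth_periodic_intros abc)+
qed

lemma sections_algebra:
  assumes "V \<in> sections" "W \<in> sections"
  shows "V + W \<in> sections" "V - W \<in> sections" "s *\<^sub>R V \<in> sections"
proof -
  obtain a b c where abc: "smooth_periodic a" "smooth_periodic b" "smooth_periodic c" "V = comb a b c"
    using section_combE[OF assms(1)] .
  obtain a' b' c' where abc': "smooth_periodic a'" "smooth_periodic b'" "smooth_periodic c'" "W = comb a' b' c'"
    using section_combE[OF assms(2)] .
  show "V + W \<in> sections" "V - W \<in> sections" "s *\<^sub>R V \<in> sections"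
    unfolding abc(4) abc'(4) comb_algebra
    by (rule comb_section; intro smooth_periodic_intros abc abc')+
qed

section \<open>The formal adjoint\<close>

text \<open>The connection is metric: the multiples of \<phi> subtracted by \<open>nabla\<close> are
  orthogonal to sections.\<close>

lemma D_inner_sections:
  assumes "V \<in> sections" "W \<in> sections"
  shows "D u (\<lambda>x. V x \<bullet> W x) x = nabla V x u \<bullet> W x + V x \<bullet> nabla W x u"
proof -
  have s: "smooth V" "smooth W" "V x \<bullet> \<phi> x = 0" "W x \<bullet> \<phi> x = 0"
    by (intro sectionsD assms)+
  have "D u (\<lambda>x. V x \<bullet> W x) x = V x \<bullet> D u W x + D u V x \<bullet> W x"
    using fun_cong[OF D_inner[OF s(1,2)]] .
  then show ?thesis
    using s(3,4) by (simp add: nabla_def Let_def inner_diff_left inner_diff_right inner_commute)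
qed

text \<open>Testing with the difference of the two sections makes the integral of its squared norm
  vanish. This is the uniqueness behind the definite description in \<open>dstar\<close>.\<close>

lemma section_eqI:
  assumes S: "S \<in> sections" "S' \<in> sections"
    and eq: "\<And>W. W \<in> sections \<Longrightarrow> integral_torus (\<lambda>x. S x \<bullet> W x) = integral_torus (\<lambda>x. S' x \<bullet> W x)"
  shows "S = S'"
proof -
  define T where "T = S - S'"
  have T: "T \<in> sections" unfolding T_def by (rule sections_algebra[OF S])
  have c: "continuous_on square S" "continuous_on square S'" "continuous_on square T"
    by (intro smooth_continuous sectionsD S T)+
  have "integral square (\<lambda>x. S x \<bullet> T x / 4) - integral square (\<lambda>x. S' x \<bullet> T x / 4) = 0"
    using eq[OF T] by (simp add: integral_torus_def)
  also have "integral square (\<lambda>x. S x \<bullet> T x / 4) - integral square (\<lambda>x. S' x \<bullet> T x / 4)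
      = integral square (\<lambda>x. S x \<bullet> T x / 4 - S' x \<bullet> T x / 4)"
    by (rule integral_diff[symmetric]) (intro integrable_continuous continuous_intros c; simp)+
  also have "(\<lambda>x. S x \<bullet> T x / 4 - S' x \<bullet> T x / 4) = (\<lambda>x. T x \<bullet> T x / 4)"
    by (simp add: T_def inner_diff_left diff_divide_distrib)
  finally have "integral square (\<lambda>x. T x \<bullet> T x / 4) = 0" .
  then have "\<forall>x\<in>square. T x \<bullet> T x / 4 = 0"
    by (subst integral_cbox_eq_0_iff[symmetric])
      (auto intro!: continuous_intros c simp: box_ne_empty Basis_prod_def)
  moreover have "\<exists>y\<in>square. T x = T y" for x
    using reduce_to_square[of x] periodic_factors_through_clifford[OF sectionsD(2)[OF T]] by metis
  ultimately have "T x = 0" for x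
    by (metis divide_eq_0_iff inner_eq_zero_iff zero_neq_numeral)
  then show ?thesis by (simp add: T_def fun_eq_iff)
qed

text \<open>The frame (2, 0), (0, 2) has constant coordinates on a flat torus, so the adjoint is
  minus the sum of covariant derivatives, with no correction from the connection of the
  domain.\<close>

lemma dstar_eq:
  assumes \<omega>: "\<And>e. (\<lambda>x. \<omega> x e) \<in> sections"
  shows "dstar \<omega> = - (\<lambda>x. nabla (\<lambda>y. \<omega> y (2, 0)) x (2, 0)) - (\<lambda>x. nabla (\<lambda>y. \<omega> y (0, 2)) x (0, 2))"
    (is "_ = ?S")
proof -
  have "?S = (- 1) *\<^sub>R (\<lambda>x. nabla (\<lambda>y. \<omega> y (2, 0)) x (2, 0)) - (\<lambda>x. nabla (\<lambda>y. \<omega> y (0, 2)) x (0, 2))"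
    by simp
  then have S: "?S \<in> sections"
    using sections_algebra nabla_section[OF \<omega>] by metis
  have pairing: "integral_torus (\<lambda>x. ?S x \<bullet> W x) = integral_torus (inner_form \<omega> (nabla W))"
    if W: "W \<in> sections" for W
  proof -
    have sm: "smooth (\<lambda>x. \<omega> x e)" "smooth W" "smooth (\<lambda>x. nabla W x e)" "smooth ?S" for e
      by (intro sectionsD \<omega> W S nabla_section)+
    have s: "smooth (\<lambda>x. \<omega> x e \<bullet> W x)" "periodic (\<lambda>x. \<omega> x e \<bullet> W x)" for e
      using sectionsD(2)[OF \<omega>] sectionsD(2)[OF W] by (auto simp: periodic_def intro!: smooth_inner sm)
    have I: "integral square (\<lambda>x. D e (\<lambda>x. \<omega> x e \<bullet> W x) x / 4) = 0" for e
      using integral_D_periodic[OF s(2,1)] by simp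
    have c: "continuous_on square (\<lambda>x. D e (\<lambda>x. \<omega> x e \<bullet> W x) x / 4)" for e
      by (intro continuous_on_divide smooth_continuous[OF smooth_D[OF s(1)]] continuous_on_const) simp
    have form: "inner_form \<omega> (nabla W) x = \<omega> x (2, 0) \<bullet> nabla W x (2, 0) + \<omega> x (0, 2) \<bullet> nabla W x (0, 2)" for x
      by (simp add: inner_form_def frame_def)
    have cS: "continuous_on square (\<lambda>x. ?S x \<bullet> W x / 4)"
      by (intro continuous_intros smooth_continuous sm) simp
    \<comment> \<open>The two integrands differ by a divergence, which integrates to 0 by
      \<open>I\<close>.\<close>
    have "inner_form \<omega> (nabla W) x / 4 = ?S x \<bullet> W x / 4
        + (D (2, 0) (\<lambda>x. \<omega> x (2, 0) \<bullet> W x) x / 4 + D (0, 2) (\<lambda>x. \<omega> x (0, 2) \<bullet> W x) x / 4)" for x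
      unfolding form D_inner_sections[OF \<omega> W] by (simp add: inner_diff_left field_simps)
    then have "integral_torus (inner_form \<omega> (nabla W)) = integral square (\<lambda>x. ?S x \<bullet> W x / 4
        + (D (2, 0) (\<lambda>x. \<omega> x (2, 0) \<bullet> W x) x / 4 + D (0, 2) (\<lambda>x. \<omega> x (0, 2) \<bullet> W x) x / 4))"
      unfolding integral_torus_def by presburger
    also have "\<dots> = integral square (\<lambda>x. ?S x \<bullet> W x / 4) + integral square
        (\<lambda>x. D (2, 0) (\<lambda>x. \<omega> x (2, 0) \<bullet> W x) x / 4 + D (0, 2) (\<lambda>x. \<omega> x (0, 2) \<bullet> W x) x / 4)"
      by (intro integral_add integrable_continuous continuous_on_add c cS)
    also have "integral square (\<lambda>x. D (2, 0) (\<lambda>x. \<omega> x (2, 0) \<bullet> W x) x / 4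
          + D (0, 2) (\<lambda>x. \<omega> x (0, 2) \<bullet> W x) x / 4) = 0"
      unfolding integral_add[OF integrable_continuous[OF c] integrable_continuous[OF c]] I by simp
    finally show ?thesis by (simp add: integral_torus_def)
  qed
  show ?thesis
    unfolding dstar_def
  proof (rule the_equality)
    show "?S \<in> sections \<and> (\<forall>W\<in>sections. integral_torus (\<lambda>x. ?S x \<bullet> W x) = integral_torus (inner_form \<omega> (nabla W)))"
      using S pairing by blast
    show "T = ?S" if "T \<in> sections \<and> (\<forall>W\<in>sections. integral_torus (\<lambda>x. T x \<bullet> W x) = integral_torus (inner_form \<omega> (nabla W)))" for T
      using that pairing S by (intro section_eqI) auto
  qed
qed

section \<open>The Jacobi operator in the frame\<close>

lemma D_lin:
  fixes f g :: "real \<times> real \<Rightarrow> real"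
  shows "smooth_periodic f \<Longrightarrow> smooth_periodic g \<Longrightarrow> D v (\<lambda>x. f x + g x) x = D v f x + D v g x"
    "smooth_periodic f \<Longrightarrow> smooth_periodic g \<Longrightarrow> D v (\<lambda>x. f x - g x) x = D v f x - D v g x"
    "smooth_periodic f \<Longrightarrow> D v (\<lambda>x. k * f x) x = k * D v f x"
  unfolding smooth_periodic_def
  by (erule conjE, (erule conjE)?, rule fun_cong[OF D_add] fun_cong[OF D_diff]
      fun_cong[OF D_bounded_linear[OF bounded_linear_mult_right]]; assumption)+

lemma tangential_comb: "tangential (comb a b c) = comb a b (\<lambda>x. 0)"
proof
  fix x
  show "tangential (comb a b c) x = comb a b (\<lambda>x. 0) x"
    unfolding tangential_def
  proof (rule the_equality)
    show "comb a b (\<lambda>x. 0) x \<in> range (d\<phi> x) \<and> (\<forall>u. (comb a b c x - comb a b (\<lambda>x. 0) x) \<bullet> d\<phi> x u = 0)"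
    proof
      show "comb a b (\<lambda>x. 0) x \<in> range (d\<phi> x)"
        \<comment> \<open>The factors 2 cancel the 1 / 2 in \<open>d\<phi>\<close>.\<close>
        by (rule range_eqI[of _ _ "(2 * a x, 2 * b x)"]) (simp add: D_frame(4) comb_def algebra_simps)
    qed (simp add: D_frame(4) comb_def inner_add_right)
  next
    fix w assume w: "w \<in> range (d\<phi> x) \<and> (\<forall>u. (comb a b c x - w) \<bullet> d\<phi> x u = 0)"
    then obtain u where u: "w = d\<phi> x u" by blast
    have "(comb a b c x - w) \<bullet> d\<phi> x (2, 0) = 0" "(comb a b c x - w) \<bullet> d\<phi> x (0, 2) = 0"
      using w by blast+
    then have "fst u / 2 = a x" "snd u / 2 = b x"
      by (simp_all add: u D_frame(4) comb_inner inner_diff_left inner_add_left)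
    then show "w = comb a b (\<lambda>x. 0) x"
      unfolding u D_frame(4) comb_def by (simp add: scaleR_add_right)
  qed
qed

text \<open>Derivatives along the orthonormal frame, i.e. twice the coordinate derivatives.\<close>

definition dgamma :: "(real \<times> real \<Rightarrow> real) \<Rightarrow> real \<times> real \<Rightarrow> real" where
  "dgamma f = D (2, 0) f"

definition dtheta :: "(real \<times> real \<Rightarrow> real) \<Rightarrow> real \<times> real \<Rightarrow> real" where
  "dtheta f = D (0, 2) f"

lemma sqrt2_simps: "2 / sqrt 2 = sqrt 2" "sqrt 2 * sqrt 2 = 2"
  by (simp_all add: real_div_sqrt)

text \<open>The zeroth-order terms are squared principal curvatures: each tangential component
  receives one of them, 2, and the normal component receives their sum, 4.\<close>

lemma rough_laplacian_comb:
  assumes abc: "smooth_periodic a" "smooth_periodic b" "smooth_periodic c"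
  shows "rough_laplacian (comb a b c) = comb
    (\<lambda>x. - dgamma (dgamma a) x - dtheta (dtheta a) x - 2 * sqrt 2 * dgamma c x + 2 * a x)
    (\<lambda>x. - dgamma (dgamma b) x - dtheta (dtheta b) x + 2 * sqrt 2 * dtheta c x + 2 * b x)
    (\<lambda>x. - dgamma (dgamma c) x - dtheta (dtheta c) x + 2 * sqrt 2 * (dgamma a x - dtheta b x) + 4 * c x)"
proof -
  note [simp] = abc smooth_periodic_intros
  have n: "(\<lambda>x. nabla (comb a b c) x u) = comb (\<lambda>x. D u a x + fst u / sqrt 2 * c x)
    (\<lambda>x. D u b x - snd u / sqrt 2 * c x)
    (\<lambda>x. D u c x - fst u / sqrt 2 * a x + snd u / sqrt 2 * b x)" for u
    by (rule ext) (rule nabla_comb[OF abc])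
  have n1: "(\<lambda>x. nabla (comb a b c) x (2, 0)) = comb (\<lambda>x. D (2, 0) a x + sqrt 2 * c x)
      (\<lambda>x. D (2, 0) b x) (\<lambda>x. D (2, 0) c x - sqrt 2 * a x)"
    unfolding n by (simp add: sqrt2_simps)
  have n2: "(\<lambda>x. nabla (comb a b c) x (0, 2)) = comb (\<lambda>x. D (0, 2) a x)
      (\<lambda>x. D (0, 2) b x - sqrt 2 * c x) (\<lambda>x. D (0, 2) c x + sqrt 2 * b x)"
    unfolding n by (simp add: sqrt2_simps)
  show ?thesis
    unfolding rough_laplacian_def dstar_eq[OF nabla_section[OF comb_section[OF abc]]] n1 n2
  proof
    fix x
    have r1: "nabla (comb (\<lambda>x. D (2, 0) a x + sqrt 2 * c x) (\<lambda>x. D (2, 0) b x) (\<lambda>x. D (2, 0) c x - sqrt 2 * a x)) x (2, 0)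
      = comb (\<lambda>x. D (2, 0) (D (2, 0) a) x + 2 * sqrt 2 * D (2, 0) c x - 2 * a x)
          (\<lambda>x. D (2, 0) (D (2, 0) b) x)
          (\<lambda>x. D (2, 0) (D (2, 0) c) x - 2 * sqrt 2 * D (2, 0) a x - 2 * c x) x"
      by (subst nabla_comb) (simp_all add: D_lin comb_def sqrt2_simps, simp add: algebra_simps)
    have r2: "nabla (comb (\<lambda>x. D (0, 2) a x) (\<lambda>x. D (0, 2) b x - sqrt 2 * c x) (\<lambda>x. D (0, 2) c x + sqrt 2 * b x)) x (0, 2)
      = comb (\<lambda>x. D (0, 2) (D (0, 2) a) x)
          (\<lambda>x. D (0, 2) (D (0, 2) b) x - 2 * sqrt 2 * D (0, 2) c x - 2 * b x)
          (\<lambda>x. D (0, 2) (D (0, 2) c) x + 2 * sqrt 2 * D (0, 2) b x - 2 * c x) x"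
      by (subst nabla_comb) (simp_all add: D_lin comb_def sqrt2_simps, simp add: algebra_simps)
    show "(- (\<lambda>x. nabla (comb (\<lambda>x. D (2, 0) a x + sqrt 2 * c x) (\<lambda>x. D (2, 0) b x) (\<lambda>x. D (2, 0) c x - sqrt 2 * a x)) x (2, 0))
        - (\<lambda>x. nabla (comb (\<lambda>x. D (0, 2) a x) (\<lambda>x. D (0, 2) b x - sqrt 2 * c x) (\<lambda>x. D (0, 2) c x + sqrt 2 * b x)) x (0, 2))) x
      = comb (\<lambda>x. - dgamma (dgamma a) x - dtheta (dtheta a) x - 2 * sqrt 2 * dgamma c x + 2 * a x)
        (\<lambda>x. - dgamma (dgamma b) x - dtheta (dtheta b) x + 2 * sqrt 2 * dtheta c x + 2 * b x)
        (\<lambda>x. - dgamma (dgamma c) x - dtheta (dtheta c) x + 2 * sqrt 2 * (dgamma a x - dtheta b x) + 4 * c x) x"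
      unfolding minus_apply uminus_apply r1 r2
      by (simp add: comb_def dgamma_def dtheta_def vec_eq_iff algebra_simps)
  qed
qed

text \<open>All zeroth-order terms cancel: 2 - 4 + 2 on tangential components and 4 - 4 on the
  normal one. This is why constant triples lie in the kernel.\<close>

lemma p_jacobi_comb:
  assumes abc: "smooth_periodic a" "smooth_periodic b" "smooth_periodic c"
  shows "p_jacobi p (comb a b c) = 2 powr ((p - 2) / 2) *\<^sub>R comb
    (\<lambda>x. - dgamma (dgamma a) x - dtheta (dtheta a) x - 2 * sqrt 2 * dgamma c x
        - (p - 2) / 2 * (dgamma (dgamma a) x + dgamma (dtheta b) x))
    (\<lambda>x. - dgamma (dgamma b) x - dtheta (dtheta b) x + 2 * sqrt 2 * dtheta c x
        - (p - 2) / 2 * (dtheta (dgamma a) x + dtheta (dtheta b) x))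
    (\<lambda>x. - dgamma (dgamma c) x - dtheta (dtheta c) x + 2 * sqrt 2 * (dgamma a x - dtheta b x))"
proof -
  note [simp] = abc smooth_periodic_intros
  let ?f = "\<lambda>x. dgamma a x + dtheta b x"
  have f [simp]: "smooth_periodic ?f" "smooth_periodic (dgamma a)" "smooth_periodic (dtheta b)"
    by (simp_all add: dgamma_def dtheta_def)
  \<comment> \<open>By minimality the two contributions of \<open>c\<close> cancel, leaving the
    divergence of the tangential part. For the same reason the normal parts cancel in
    \<open>dst\<close>, leaving minus its gradient.\<close>
  have div: "inner_form (nabla (comb a b c)) d\<phi> x = ?f x" for x
    by (simp add: inner_form_def frame_def nabla_comb D_frame(4) comb_inner add_divide_distrib diff_divide_distrib
        dgamma_def dtheta_def)
  have grad: "(\<lambda>x. ?f x *\<^sub>R d\<phi> x u) = comb (\<lambda>x. fst u / 2 * ?f x) (\<lambda>x. snd u / 2 * ?f x) (\<lambda>x. 0)" for u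
    by (rule ext) (simp add: D_frame(4) comb_def algebra_simps)
  have grad_section: "(\<lambda>x. ?f x *\<^sub>R d\<phi> x u) \<in> sections" for u
    unfolding grad by (intro comb_section smooth_periodic_intros f)
  have grad1: "(\<lambda>x. ?f x *\<^sub>R d\<phi> x (2, 0)) = comb ?f (\<lambda>x. 0) (\<lambda>x. 0)"
    and grad2: "(\<lambda>x. ?f x *\<^sub>R d\<phi> x (0, 2)) = comb (\<lambda>x. 0) ?f (\<lambda>x. 0)"
    unfolding grad by simp_all
  have n1: "nabla (comb ?f (\<lambda>x. 0) (\<lambda>x. 0)) x (2, 0) = comb (dgamma ?f) (\<lambda>x. 0) (\<lambda>x. - sqrt 2 * ?f x) x"
    and n2: "nabla (comb (\<lambda>x. 0) ?f (\<lambda>x. 0)) x (0, 2) = comb (\<lambda>x. 0) (dtheta ?f) (\<lambda>x. sqrt 2 * ?f x) x" for x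
    unfolding dgamma_def[of ?f] dtheta_def[of ?f]
    by (subst nabla_comb[OF f(1) smooth_periodic_intros(1,1)] nabla_comb[OF smooth_periodic_intros(1) f(1) smooth_periodic_intros(1)];
        simp add: comb_def sqrt2_simps)+
  have dst: "dstar (\<lambda>x u. inner_form (nabla (comb a b c)) d\<phi> x *\<^sub>R d\<phi> x u)
      = comb (\<lambda>x. - dgamma ?f x) (\<lambda>x. - dtheta ?f x) (\<lambda>x. 0)"
    unfolding div dstar_eq[OF grad_section] grad1 grad2 n1 n2
    by (rule ext) (simp add: comb_def)
  have split: "dgamma ?f x = dgamma (dgamma a) x + dgamma (dtheta b) x"
    "dtheta ?f x = dtheta (dgamma a) x + dtheta (dtheta b) x" for x
    using D_lin(1)[OF f(2,3)] by (simp_all only: dgamma_def[of ?f] dgamma_def[of "dgamma a"] dgamma_def[of "dtheta b"] dtheta_def[of ?f] dtheta_def[of "dgamma a"] dtheta_def[of "dtheta b"])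
  have half: "2 powr ((p - 4) / 2) = 2 powr ((p - 2) / 2) / 2"
    using powr_diff[of 2 "(p - 2) / 2" 1] by (simp add: diff_divide_distrib)
  show ?thesis
    unfolding p_jacobi_def jacobi_def rough_laplacian_comb[OF abc] tangential_comb dst half
      comb_algebra(1-3) comb_eq_iff split
    by (intro conjI ext) (simp_all add: field_simps)
qed

section \<open>Real trigonometric modes\<close>

definition mode :: "complex \<Rightarrow> int \<Rightarrow> int \<Rightarrow> real \<times> real \<Rightarrow> real" where
  "mode z m n x = Re (z * exp_mode m n x)"

lemma mode_0: "mode 0 m n x = 0"
  by (simp add: mode_def)

lemma smooth_periodic_mode: "smooth_periodic (mode z m n)"
  unfolding smooth_periodic_def mode_def[abs_def]
  using periodic_exp_mode[of m n] smooth_Re[OF smooth_mult[OF smooth_const smooth_exp_mode]]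
  by (simp add: periodic_def)

lemma D_mode: "D v (mode z m n) = mode (\<i> * of_real (of_int m * fst v + of_int n * snd v) * z) m n"
proof -
  have "D v (mode z m n) = (\<lambda>x. Re (z * D v (exp_mode m n) x))"
    unfolding mode_def[abs_def]
    by (rule D_bounded_linear[OF _ smooth_exp_mode])
      (intro bounded_linear_compose[OF bounded_linear_Re bounded_linear_mult_right])
  also have "\<dots> = mode (\<i> * of_real (of_int m * fst v + of_int n * snd v) * z) m n"
    unfolding mode_def[abs_def] D_exp_mode[THEN fun_cong] by (intro ext arg_cong[of _ _ Re]) (simp add: mult_ac)
  finally show ?thesis .
qed

lemma dgamma_mode: "dgamma (mode z m n) = mode (2 * \<i> * of_int m * z) m n"
  and dtheta_mode: "dtheta (mode z m n) = mode (2 * \<i> * of_int n * z) m n"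
  by (simp_all add: dgamma_def dtheta_def D_mode mult_ac)

text \<open>A mode is half an exponential plus half its conjugate. Both conditions hold together
  only when m = n = 0, where the coefficient is the full real part of \<open>z\<close> instead of
  \<open>z / 2\<close>.\<close>

lemma fourier_mode:
  "fourier (mode z m n) m' n' = (if m' = m \<and> n' = n then z / 2 else 0)
    + (if m' = - m \<and> n' = - n then cnj z / 2 else 0)"
proof -
  have re: "of_real (Re w) = (w + cnj w) / 2" for w by (simp add: complex_eq_iff)
  have "of_real (mode z m n x) * exp_mode (- m') (- n') x
      = z / 2 * exp_mode (m - m') (n - n') x + cnj z / 2 * exp_mode (- m - m') (- n - n') x" for x
    unfolding mode_def re complex_cnj_mult cnj_exp_mode
    using exp_mode_mult[of m n x "- m'" "- n'"] exp_mode_mult[of "- m" "- n" x "- m'" "- n'"]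
    by (simp add: field_simps)
  moreover have "exp_mode k l integrable_on square" for k l
    by (intro integrable_continuous smooth_continuous smooth_exp_mode)
  ultimately have "fourier (mode z m n) m' n' = (z / 2 * integral square (exp_mode (m - m') (n - n'))
      + cnj z / 2 * integral square (exp_mode (- m - m') (- n - n'))) / (4 * pi\<^sup>2)"
    unfolding fourier_def by (simp add: integral_add integrable_on_mult_right)
  then show ?thesis
    unfolding integral_exp_mode by (auto simp: add_divide_distrib)
qed

lemma smooth_periodic_continuous: "smooth_periodic f \<Longrightarrow> continuous_on S f"
  by (simp add: smooth_periodic_def smooth_continuous)

lemma fourier_linear:
  assumes "smooth_periodic f"
  shows "smooth_periodic g \<Longrightarrow> fourier (\<lambda>x. f x + g x) m n = fourier f m n + fourier g m n"
    "smooth_periodic g \<Longrightarrow> fourier (\<lambda>x. f x - g x) m n = fourier f m n - fourier g m n"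
    "fourier (\<lambda>x. s * f x) m n = s * fourier f m n"
    "fourier (\<lambda>x. - f x) m n = - fourier f m n"
    "fourier (dgamma f) m n = 2 * \<i> * of_int m * fourier f m n"
    "fourier (dtheta f) m n = 2 * \<i> * of_int n * fourier f m n"
  using assms
  by (simp_all add: fourier_add fourier_diff fourier_minus fourier_cmult smooth_periodic_continuous
      dgamma_def dtheta_def fourier_D[of f] smooth_periodic_def)

lemma fourier_eqI:
  assumes "smooth_periodic f" "smooth_periodic g" "\<And>m n. fourier f m n = fourier g m n"
  shows "f = g"
proof -
  have d: "smooth_periodic (\<lambda>x. f x - g x)"
    using assms by (intro smooth_periodic_intros)
  have "(\<lambda>x. f x - g x) = (\<lambda>x. 0)"
    using d assms by (intro fourier_unique) (auto simp: smooth_periodic_continuous fourier_linear smooth_periodic_def[of "\<lambda>x. f x - g x"])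
  then show ?thesis by (auto simp: fun_eq_iff)
qed

section \<open>The eigenvalue equation on Fourier modes\<close>

text \<open>
  With \<open>k = (p - 2) / 2\<close>, the corresponding eigenvalue of the Jacobi operator is \<open>4 * 2 powr k * l\<close>.
\<close>

definition eigensystem ::
    "real \<Rightarrow> real \<Rightarrow> (real \<times> real \<Rightarrow> real) \<Rightarrow> (real \<times> real \<Rightarrow> real) \<Rightarrow> (real \<times> real \<Rightarrow> real) \<Rightarrow> bool" where
  "eigensystem k l a b c \<longleftrightarrow> smooth_periodic a \<and> smooth_periodic b \<and> smooth_periodic c \<and>
    (\<forall>x. - dgamma (dgamma a) x - dtheta (dtheta a) x - 2 * sqrt 2 * dgamma c x
        - k * (dgamma (dgamma a) x + dgamma (dtheta b) x) = 4 * l * a x \<and>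
      - dgamma (dgamma b) x - dtheta (dtheta b) x + 2 * sqrt 2 * dtheta c x
        - k * (dtheta (dgamma a) x + dtheta (dtheta b) x) = 4 * l * b x \<and>
      - dgamma (dgamma c) x - dtheta (dtheta c) x + 2 * sqrt 2 * (dgamma a x - dtheta b x) = 4 * l * c x)"

lemma smooth_periodic_d:
  "smooth_periodic f \<Longrightarrow> smooth_periodic (dgamma f)" "smooth_periodic f \<Longrightarrow> smooth_periodic (dtheta f)"
  by (simp_all add: dgamma_def dtheta_def smooth_periodic_intros)

lemma eigenspace_eq:
  "eigenspace p (4 * 2 powr ((p - 2) / 2) * l) = {comb a b c |a b c. eigensystem ((p - 2) / 2) l a b c}"
proof -
  have *: "comb a b c \<in> eigenspace p (4 * 2 powr ((p - 2) / 2) * l) \<longleftrightarrow> eigensystem ((p - 2) / 2) l a b c"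
    if abc: "smooth_periodic a" "smooth_periodic b" "smooth_periodic c" for a b c
  proof -
    have eq: "(4 * 2 powr ((p - 2) / 2) * l) *\<^sub>R comb a b c
        = 2 powr ((p - 2) / 2) *\<^sub>R comb (\<lambda>x. 4 * l * a x) (\<lambda>x. 4 * l * b x) (\<lambda>x. 4 * l * c x)"
      unfolding comb_algebra(3) comb_eq_iff by (simp add: mult_ac)
    have "comb a b c \<in> eigenspace p (4 * 2 powr ((p - 2) / 2) * l) \<longleftrightarrow>
        p_jacobi p (comb a b c) = 2 powr ((p - 2) / 2) *\<^sub>R comb (\<lambda>x. 4 * l * a x) (\<lambda>x. 4 * l * b x) (\<lambda>x. 4 * l * c x)"
      unfolding eigenspace_def eq[symmetric] using comb_section[OF abc] by simp
    also have "\<dots> \<longleftrightarrow> eigensystem ((p - 2) / 2) l a b c"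
      unfolding p_jacobi_comb[OF abc] eigensystem_def scaleR_cancel_left comb_eq_iff
      unfolding fun_eq_iff using abc by auto
    finally show ?thesis .
  qed
  show ?thesis
  proof (intro equalityI subsetI)
    fix V assume V: "V \<in> eigenspace p (4 * 2 powr ((p - 2) / 2) * l)"
    then have "V \<in> sections" by (simp add: eigenspace_def)
    then obtain a b c where "smooth_periodic a" "smooth_periodic b" "smooth_periodic c" "V = comb a b c"
      by (rule section_combE)
    then show "V \<in> {comb a b c |a b c. eigensystem ((p - 2) / 2) l a b c}" using * V by blast
  qed (use * in \<open>auto simp: eigensystem_def\<close>)
qed

lemma D_lin_gt:
  assumes "smooth_periodic f" "smooth_periodic g"
  shows "dgamma (\<lambda>x. f x + g x) = (\<lambda>x. dgamma f x + dgamma g x)"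
    "dtheta (\<lambda>x. f x + g x) = (\<lambda>x. dtheta f x + dtheta g x)"
  using assms by (auto simp: dgamma_def dtheta_def D_lin)

lemma eigensystem_add:
  assumes "eigensystem k l a b c" "eigensystem k l a' b' c'"
  shows "eigensystem k l (\<lambda>x. a x + a' x) (\<lambda>x. b x + b' x) (\<lambda>x. c x + c' x)"
proof -
  have sp: "smooth_periodic a" "smooth_periodic b" "smooth_periodic c"
    "smooth_periodic a'" "smooth_periodic b'" "smooth_periodic c'"
    using assms by (auto simp: eigensystem_def)
  note lin = D_lin_gt[OF sp(1,4)]
    D_lin_gt[OF smooth_periodic_d(1)[OF sp(1)] smooth_periodic_d(1)[OF sp(4)]]
    D_lin_gt[OF smooth_periodic_d(2)[OF sp(1)] smooth_periodic_d(2)[OF sp(4)]]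
    D_lin_gt[OF sp(2,5)]
    D_lin_gt[OF smooth_periodic_d(1)[OF sp(2)] smooth_periodic_d(1)[OF sp(5)]]
    D_lin_gt[OF smooth_periodic_d(2)[OF sp(2)] smooth_periodic_d(2)[OF sp(5)]]
    D_lin_gt[OF sp(3,6)]
    D_lin_gt[OF smooth_periodic_d(1)[OF sp(3)] smooth_periodic_d(1)[OF sp(6)]]
    D_lin_gt[OF smooth_periodic_d(2)[OF sp(3)] smooth_periodic_d(2)[OF sp(6)]]
  show ?thesis
    unfolding eigensystem_def
  proof (intro conjI allI)
    fix x
    note eqs = conjunct2[OF conjunct2[OF conjunct2[OF assms(1)[unfolded eigensystem_def]]], rule_format, of x]
      conjunct2[OF conjunct2[OF conjunct2[OF assms(2)[unfolded eigensystem_def]]], rule_format, of x]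
    show "- dgamma (dgamma (\<lambda>x. a x + a' x)) x - dtheta (dtheta (\<lambda>x. a x + a' x)) x - 2 * sqrt 2 * dgamma (\<lambda>x. c x + c' x) x
        - k * (dgamma (dgamma (\<lambda>x. a x + a' x)) x + dgamma (dtheta (\<lambda>x. b x + b' x)) x) = 4 * l * (a x + a' x)"
      unfolding lin using eqs by algebra
    show "- dgamma (dgamma (\<lambda>x. b x + b' x)) x - dtheta (dtheta (\<lambda>x. b x + b' x)) x + 2 * sqrt 2 * dtheta (\<lambda>x. c x + c' x) x
        - k * (dtheta (dgamma (\<lambda>x. a x + a' x)) x + dtheta (dtheta (\<lambda>x. b x + b' x)) x) = 4 * l * (b x + b' x)"
      unfolding lin using eqs by algebra
    show "- dgamma (dgamma (\<lambda>x. c x + c' x)) x - dtheta (dtheta (\<lambda>x. c x + c' x)) x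
        + 2 * sqrt 2 * (dgamma (\<lambda>x. a x + a' x) x - dtheta (\<lambda>x. b x + b' x) x) = 4 * l * (c x + c' x)"
      unfolding lin using eqs by algebra
  qed (intro smooth_periodic_intros sp)+
qed

text \<open>
  The equations of \<open>eigensystem\<close> on the mode \<open>(m, n)\<close>, divided by \<open>4\<close>. The third one is also
  multiplied by \<open>\<i>\<close>, which makes the matrix acting on \<open>(A, B, \<i> * C)\<close> real and symmetric.
\<close>

definition symbol_kernel :: "real \<Rightarrow> real \<Rightarrow> int \<Rightarrow> int \<Rightarrow> complex \<Rightarrow> complex \<Rightarrow> complex \<Rightarrow> bool" where
  "symbol_kernel k l m n A B C \<longleftrightarrow>
    ((of_int m)\<^sup>2 + (of_int n)\<^sup>2 + of_real k * (of_int m)\<^sup>2 - of_real l) * A + of_real k * of_int m * of_int n * B - of_real (sqrt 2) * of_int m * (\<i> * C) = 0 \<and>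
    of_real k * of_int m * of_int n * A + ((of_int m)\<^sup>2 + (of_int n)\<^sup>2 + of_real k * (of_int n)\<^sup>2 - of_real l) * B + of_real (sqrt 2) * of_int n * (\<i> * C) = 0 \<and>
    of_real (sqrt 2) * of_int n * B - of_real (sqrt 2) * of_int m * A + ((of_int m)\<^sup>2 + (of_int n)\<^sup>2 - of_real l) * (\<i> * C) = 0"

lemma eigensystem_fourier:
  assumes "eigensystem k l a b c"
  shows "symbol_kernel k l m n (fourier a m n) (fourier b m n) (fourier c m n)"
proof -
  have sp [simp]: "smooth_periodic a" "smooth_periodic b" "smooth_periodic c"
    using assms by (auto simp: eigensystem_def)
  note [simp] = smooth_periodic_d smooth_periodic_intros
  let ?A = "fourier a m n" and ?B = "fourier b m n" and ?C = "fourier c m n"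
  have "fourier (\<lambda>x. - dgamma (dgamma a) x - dtheta (dtheta a) x - 2 * sqrt 2 * dgamma c x
        - k * (dgamma (dgamma a) x + dgamma (dtheta b) x)) m n = fourier (\<lambda>x. 4 * l * a x) m n"
    using assms by (simp add: eigensystem_def del: split_paired_All)
  then have e1: "4 * (((of_int m)\<^sup>2 + (of_int n)\<^sup>2 + of_real k * (of_int m)\<^sup>2 - of_real l) * ?A + of_real k * of_int m * of_int n * ?B - of_real (sqrt 2) * of_int m * (\<i> * ?C)) = 0"
    by (simp only: fourier_linear smooth_periodic_d smooth_periodic_intros sp) (simp add: power2_eq_square algebra_simps)
  have "fourier (\<lambda>x. - dgamma (dgamma b) x - dtheta (dtheta b) x + 2 * sqrt 2 * dtheta c x
        - k * (dtheta (dgamma a) x + dtheta (dtheta b) x)) m n = fourier (\<lambda>x. 4 * l * b x) m n"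
    using assms by (simp add: eigensystem_def del: split_paired_All)
  then have e2: "4 * (of_real k * of_int m * of_int n * ?A + ((of_int m)\<^sup>2 + (of_int n)\<^sup>2 + of_real k * (of_int n)\<^sup>2 - of_real l) * ?B + of_real (sqrt 2) * of_int n * (\<i> * ?C)) = 0"
    by (simp only: fourier_linear smooth_periodic_d smooth_periodic_intros sp) (simp add: power2_eq_square algebra_simps)
  have "fourier (\<lambda>x. - dgamma (dgamma c) x - dtheta (dtheta c) x
      + 2 * sqrt 2 * (dgamma a x - dtheta b x)) m n = fourier (\<lambda>x. 4 * l * c x) m n"
    using assms by (simp add: eigensystem_def del: split_paired_All)
  then have e3: "4 * \<i> * (of_real (sqrt 2) * of_int n * ?B - of_real (sqrt 2) * of_int m * ?A + ((of_int m)\<^sup>2 + (of_int n)\<^sup>2 - of_real l) * (\<i> * ?C)) = 0"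
    by (simp only: fourier_linear smooth_periodic_d smooth_periodic_intros sp) (simp add: power2_eq_square algebra_simps)
  from e1 e2 e3 show ?thesis
    unfolding symbol_kernel_def mult_eq_0_iff by simp
qed

lemma eigensystem_mode:
  assumes "symbol_kernel k l m n A B C"
  shows "eigensystem k l (mode A m n) (mode B m n) (mode C m n)"
proof -
  \<comment> \<open>The factors undo the normalisation in \<open>symbol_kernel\<close>: 4 in the
    first two equations, and 4 / \<i> = - 4 * \<i> in the third.\<close>
  have "mode (4 * (((of_int m)\<^sup>2 + (of_int n)\<^sup>2 + of_real k * (of_int m)\<^sup>2 - of_real l) * A + of_real k * of_int m * of_int n * B - of_real (sqrt 2) * of_int m * (\<i> * C))) m n x = 0"
    "mode (4 * (of_real k * of_int m * of_int n * A + ((of_int m)\<^sup>2 + (of_int n)\<^sup>2 + of_real k * (of_int n)\<^sup>2 - of_real l) * B + of_real (sqrt 2) * of_int n * (\<i> * C))) m n x = 0"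
    "mode (- 4 * \<i> * (of_real (sqrt 2) * of_int n * B - of_real (sqrt 2) * of_int m * A + ((of_int m)\<^sup>2 + (of_int n)\<^sup>2 - of_real l) * (\<i> * C))) m n x = 0" for x
    using assms by (simp_all add: symbol_kernel_def mode_0)
  then show ?thesis
    unfolding eigensystem_def
    by (simp add: smooth_periodic_mode dgamma_mode dtheta_mode mode_def power2_eq_square algebra_simps)
qed

section \<open>The kernel of the symbol\<close>

text \<open>The matrix acting on \<open>(A, B, \<i> * C)\<close> is real, so real and imaginary
  parts solve the system separately, and sum-of-squares arguments over the reals apply.\<close>

lemma symbol_kernel_iff_real:
  "symbol_kernel k l m n A B C \<longleftrightarrow>
    (\<forall>f \<in> {Re, Im}. let X = f A; Y = f B; Z = f (\<i> * C); m = of_int m; n = of_int n in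
      (m\<^sup>2 + n\<^sup>2 + k * m\<^sup>2 - l) * X + k * m * n * Y - sqrt 2 * m * Z = 0 \<and>
      k * m * n * X + (m\<^sup>2 + n\<^sup>2 + k * n\<^sup>2 - l) * Y + sqrt 2 * n * Z = 0 \<and>
      sqrt 2 * n * Y - sqrt 2 * m * X + (m\<^sup>2 + n\<^sup>2 - l) * Z = 0)"
proof -
  have real: "((of_int m)\<^sup>2 + (of_int n)\<^sup>2 + of_real k * (of_int j)\<^sup>2 - of_real l) = complex_of_real ((of_int m)\<^sup>2 + (of_int n)\<^sup>2 + k * (of_int j)\<^sup>2 - l)"
    "((of_int m)\<^sup>2 + (of_int n)\<^sup>2 - of_real l) = complex_of_real ((of_int m)\<^sup>2 + (of_int n)\<^sup>2 - l)"
    "of_real k * of_int m * of_int n = complex_of_real (k * of_int m * of_int n)"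
    "of_real (sqrt 2) * of_int j = complex_of_real (sqrt 2 * of_int j)" for j
    by simp_all
  show ?thesis
    unfolding symbol_kernel_def real complex_eq_iff by (auto simp: Let_def)
qed

text \<open>
  Pairing the system with \<open>(X, Y, Z)\<close>, multiplying by \<open>m\<^sup>2 + n\<^sup>2\<close> and completing squares; for
  \<open>m\<^sup>2 + n\<^sup>2 \<ge> 4\<close>, \<open>k \<ge> - 1 / 2\<close> and \<open>l \<le> 0\<close> every summand is nonnegative.
\<close>

lemma symbol_form:
  fixes k l m n X Y Z :: real
  assumes "(m\<^sup>2 + n\<^sup>2 + k * m\<^sup>2 - l) * X + k * m * n * Y - sqrt 2 * m * Z = 0"
    "k * m * n * X + (m\<^sup>2 + n\<^sup>2 + k * n\<^sup>2 - l) * Y + sqrt 2 * n * Z = 0"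
    "sqrt 2 * n * Y - sqrt 2 * m * X + (m\<^sup>2 + n\<^sup>2 - l) * Z = 0"
  shows "((m\<^sup>2 + n\<^sup>2) * Z - sqrt 2 * (m * X - n * Y))\<^sup>2 + (m\<^sup>2 + n\<^sup>2) * ((n * X)\<^sup>2 + (m * Y)\<^sup>2)
    + (m\<^sup>2 + n\<^sup>2) * (k + 1 / 2) * (m * X + n * Y)\<^sup>2 + (m\<^sup>2 + n\<^sup>2 - 4) / 2 * (m * X - n * Y)\<^sup>2
    + (- l) * (m\<^sup>2 + n\<^sup>2) * (X\<^sup>2 + Y\<^sup>2 + Z\<^sup>2) = 0"
proof -
  define r where "r = sqrt 2"
  have r: "r * r = 2" by (simp add: r_def)
  have "2 * (m\<^sup>2 + n\<^sup>2) * (X * ((m\<^sup>2 + n\<^sup>2 + k * m\<^sup>2 - l) * X + k * m * n * Y - r * m * Z)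
      + Y * (k * m * n * X + (m\<^sup>2 + n\<^sup>2 + k * n\<^sup>2 - l) * Y + r * n * Z)
      + Z * (r * n * Y - r * m * X + (m\<^sup>2 + n\<^sup>2 - l) * Z)) = 0"
    using assms unfolding r_def by simp
  then show ?thesis
    unfolding r_def[symmetric] using r by (simp add: field_simps) algebra
qed

text \<open>The disjunction excludes only k = - 1 / 2 with l = 0. There the conclusion fails: for m
  = 2 and n = 0, (X, Y, Z) = (sqrt 2, 0, 1) is a solution.\<close>

lemma symbol_high_modes:
  fixes k l X Y Z :: real and m n :: int
  assumes k: "k \<ge> - 1 / 2" "l \<le> 0" "l < 0 \<or> k > - 1 / 2" and s: "m\<^sup>2 + n\<^sup>2 \<ge> 4"
    and eqs: "((of_int m)\<^sup>2 + (of_int n)\<^sup>2 + k * (of_int m)\<^sup>2 - l) * X + k * of_int m * of_int n * Y - sqrt 2 * of_int m * Z = 0"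
    "k * of_int m * of_int n * X + ((of_int m)\<^sup>2 + (of_int n)\<^sup>2 + k * (of_int n)\<^sup>2 - l) * Y + sqrt 2 * of_int n * Z = 0"
    "sqrt 2 * of_int n * Y - sqrt 2 * of_int m * X + ((of_int m)\<^sup>2 + (of_int n)\<^sup>2 - l) * Z = 0"
  shows "X = 0 \<and> Y = 0 \<and> Z = 0"
proof -
  define M N S where "M = real_of_int m" "N = real_of_int n" "S = M\<^sup>2 + N\<^sup>2"
  have "real_of_int 4 \<le> real_of_int (m\<^sup>2 + n\<^sup>2)" using s by (simp only: of_int_le_iff)
  then have S: "S \<ge> 4" by (simp add: M_N_S_def)
  define t1 t2 t3 t4 t5 where "t1 = (S * Z - sqrt 2 * (M * X - N * Y))\<^sup>2"
    "t2 = S * ((N * X)\<^sup>2 + (M * Y)\<^sup>2)" "t3 = S * (k + 1 / 2) * (M * X + N * Y)\<^sup>2"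
    "t4 = (S - 4) / 2 * (M * X - N * Y)\<^sup>2" "t5 = (- l) * S * (X\<^sup>2 + Y\<^sup>2 + Z\<^sup>2)"
  have sum: "t1 + t2 + t3 + t4 + t5 = 0"
    using symbol_form[OF eqs] by (simp add: t1_t2_t3_t4_t5_def M_N_S_def)
  have "t1 \<ge> 0" "t2 \<ge> 0" "t3 \<ge> 0" "t4 \<ge> 0" "t5 \<ge> 0"
    using S k by (simp_all add: t1_t2_t3_t4_t5_def mult_nonpos_nonneg)
  with sum have zero: "t1 = 0" "t2 = 0" "t3 = 0" "t5 = 0" by linarith+
  from k(3) show ?thesis
  proof
    assume "l < 0"
    then have "X\<^sup>2 + Y\<^sup>2 + Z\<^sup>2 = 0" using zero(4) S by (simp add: t1_t2_t3_t4_t5_def)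
    then show ?thesis
      by (simp add: add_nonneg_eq_0_iff)
  next
    assume "k > - 1 / 2"
    then have P: "M * X + N * Y = 0"
      using zero(3) S by (simp add: t1_t2_t3_t4_t5_def)
    have "(N * X)\<^sup>2 + (M * Y)\<^sup>2 = 0" using zero(2) S by (simp add: t1_t2_t3_t4_t5_def)
    then have Q: "N * X = 0" "M * Y = 0" by (simp_all add: add_nonneg_eq_0_iff)
    have "M \<noteq> 0 \<or> N \<noteq> 0" using S by (auto simp: M_N_S_def)
    with P Q have XY: "X = 0" "Y = 0" by auto
    then have "Z = 0" using zero(1) S by (simp add: t1_t2_t3_t4_t5_def)
    with XY show ?thesis by simp
  qed
qed

text \<open>Here m^2 + n^2 - 4 is negative, but m^2 = n^2 = 1 gives 2 (X^2 + Y^2) = (m X + n Y)^2 +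
  (m X - n Y)^2, which absorbs that term and leaves the three nonnegative terms below.\<close>

lemma symbol_diagonal_modes:
  fixes k l m n X Y Z :: real
  assumes k: "k \<ge> - 1 / 2" "l \<le> 0" and s: "m\<^sup>2 = 1" "n\<^sup>2 = 1"
    and eqs: "(m\<^sup>2 + n\<^sup>2 + k * m\<^sup>2 - l) * X + k * m * n * Y - sqrt 2 * m * Z = 0"
    "k * m * n * X + (m\<^sup>2 + n\<^sup>2 + k * n\<^sup>2 - l) * Y + sqrt 2 * n * Z = 0"
    "sqrt 2 * n * Y - sqrt 2 * m * X + (m\<^sup>2 + n\<^sup>2 - l) * Z = 0"
  shows "(l < 0 \<longrightarrow> X = 0 \<and> Y = 0 \<and> Z = 0) \<and> X = m * Z / sqrt 2 \<and> Y = - n * Z / sqrt 2"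
proof -
  define t1 t2 t3 where "t1 = (2 * Z - sqrt 2 * (m * X - n * Y))\<^sup>2"
    "t2 = 2 * (1 + k) * (m * X + n * Y)\<^sup>2" "t3 = (- l) * 2 * (X\<^sup>2 + Y\<^sup>2 + Z\<^sup>2)"
  have sum: "t1 + t2 + t3 = 0"
    using symbol_form[OF eqs] s
    by (simp add: t1_t2_t3_def power2_sum power2_diff power_mult_distrib algebra_simps)
  have "t1 \<ge> 0" "t2 \<ge> 0" "t3 \<ge> 0"
    using k by (simp_all add: t1_t2_t3_def mult_nonpos_nonneg)
  with sum have zero: "t1 = 0" "t2 = 0" "t3 = 0" by linarith+
  have neg: "X = 0 \<and> Y = 0 \<and> Z = 0" if "l < 0"
  proof -
    have "X\<^sup>2 + Y\<^sup>2 + Z\<^sup>2 = 0" using zero(3) that by (simp add: t1_t2_t3_def)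
    then show ?thesis
      by (simp add: add_nonneg_eq_0_iff)
  qed
  have P: "m * X + n * Y = 0" using zero(2) k by (simp add: t1_t2_t3_def)
  have Q: "2 * Z = sqrt 2 * (m * X - n * Y)" using zero(1) by (simp add: t1_t2_t3_def)
  have "sqrt 2 * (Z / sqrt 2) = Z" "sqrt 2 * sqrt 2 = 2" by simp_all
  with Q have R: "2 * (Z / sqrt 2) = m * X - n * Y" by algebra
  have "X = m * (Z / sqrt 2)" "Y = - n * (Z / sqrt 2)"
    using P R s by algebra+
  with neg show ?thesis by simp
qed

lemma symbol_kernel_high:
  assumes "symbol_kernel k l m n A B C" "k \<ge> - 1 / 2" "l \<le> 0" "l < 0 \<or> k > - 1 / 2" "m\<^sup>2 + n\<^sup>2 \<ge> 4"
  shows "A = 0" "B = 0" "C = 0"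
proof -
  have "f A = 0 \<and> f B = 0 \<and> f (\<i> * C) = 0" if "f \<in> {Re, Im}" for f
    using assms(1) that unfolding symbol_kernel_iff_real Let_def
    by (intro symbol_high_modes[OF assms(2-5)]) blast+
  from this[of Re] this[of Im] show "A = 0" "B = 0" "C = 0" by (auto simp: complex_eq_iff)
qed

lemma symbol_kernel_diagonal:
  assumes "symbol_kernel k l m n A B C" "k \<ge> - 1 / 2" "l \<le> 0" "m\<^sup>2 = 1" "n\<^sup>2 = 1"
  shows "A = of_int m * (\<i> * C) / of_real (sqrt 2)" "B = - of_int n * (\<i> * C) / of_real (sqrt 2)"
    "l < 0 \<Longrightarrow> C = 0"
proof -
  have s: "(real_of_int m)\<^sup>2 = 1" "(real_of_int n)\<^sup>2 = 1"
    using assms(4,5) by (metis of_int_1 of_int_power)+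
  have *: "(l < 0 \<longrightarrow> f A = 0 \<and> f B = 0 \<and> f (\<i> * C) = 0) \<and> f A = of_int m * f (\<i> * C) / sqrt 2
      \<and> f B = - of_int n * f (\<i> * C) / sqrt 2" if "f \<in> {Re, Im}" for f
    using assms(1) that unfolding symbol_kernel_iff_real Let_def
    by (intro symbol_diagonal_modes[OF assms(2,3) s]) blast+
  show "A = of_int m * (\<i> * C) / of_real (sqrt 2)" "B = - of_int n * (\<i> * C) / of_real (sqrt 2)"
    "l < 0 \<Longrightarrow> C = 0"
    using *[of Re] *[of Im] by (auto simp: complex_eq_iff Re_divide_of_real Im_divide_of_real)
qed

text \<open>The roots of \<open>char_poly k\<close> are the eigenvalues other than \<open>1\<close> on the modes \<open>(\<plusminus>1, 0)\<close> and \<open>(0, \<plusminus>1)\<close>.\<close>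

definition char_poly :: "real \<Rightarrow> real \<Rightarrow> real" where
  "char_poly k l = (1 + k - l) * (1 - l) - 2"

text \<open>One tangential component decouples, with factor 1 - l \<noteq> 0. The other forms with
  \<open>\<i> * C\<close> a 2 x 2 system of determinant \<open>char_poly k l\<close>, whose third
  equation determines it from \<open>C\<close>.\<close>

lemma symbol_kernel_axis:
  assumes "l \<le> 0"
  shows "symbol_kernel k l 1 0 A B C \<longleftrightarrow>
      A = (1 - of_real l) * (\<i> * C) / of_real (sqrt 2) \<and> B = 0 \<and> (char_poly k l = 0 \<or> C = 0)"
    and "symbol_kernel k l 0 1 A B C \<longleftrightarrow>
      A = 0 \<and> B = - (1 - of_real l) * (\<i> * C) / of_real (sqrt 2) \<and> (char_poly k l = 0 \<or> C = 0)"
proof -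
  define r :: complex where "r = of_real (sqrt 2)"
  have r: "r * r = 2" "r \<noteq> 0"
    by (simp_all add: r_def flip: of_real_mult)
  define L K c where "L = complex_of_real l" "K = complex_of_real k" "c = \<i> * C"
  have L: "1 - L \<noteq> 0"
    using assms by (simp add: L_K_c_def complex_eq_iff)
  have c0: "c = 0 \<longleftrightarrow> C = 0" by (simp add: L_K_c_def)
  have cp: "char_poly k l = 0 \<longleftrightarrow> (1 + K - L) * (1 - L) - 2 = 0"
    unfolding char_poly_def L_K_c_def by (metis (no_types) of_real_1 of_real_add of_real_diff of_real_eq_0_iff of_real_mult of_real_numeral)
  have div: "X = Y / r \<longleftrightarrow> r * X = Y" for X Y using r by (auto simp: field_simps)
  have "symbol_kernel k l 1 0 A B C \<longleftrightarrow> (1 + K - L) * A - r * c = 0 \<and> (1 - L) * B = 0 \<and> - r * A + (1 - L) * c = 0"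
    unfolding symbol_kernel_def by (simp add: L_K_c_def r_def)
  also have "\<dots> \<longleftrightarrow> r * A = (1 - L) * c \<and> B = 0 \<and> ((1 + K - L) * (1 - L) - 2 = 0 \<or> c = 0)"
  proof -
    have "r * ((1 + K - L) * A - r * c) = ((1 + K - L) * (1 - L) - 2) * c" if "r * A = (1 - L) * c"
      using that r(1) by algebra
    then have "(1 + K - L) * A - r * c = 0 \<longleftrightarrow> (1 + K - L) * (1 - L) - 2 = 0 \<or> c = 0" if "r * A = (1 - L) * c"
      using that r(2) by (metis mult_eq_0_iff)
    moreover have "- r * A + (1 - L) * c = 0 \<longleftrightarrow> r * A = (1 - L) * c"
      by (intro iffI; algebra)
    ultimately show ?thesis using L unfolding mult_eq_0_iff by blast
  qed
  finally show "symbol_kernel k l 1 0 A B C \<longleftrightarrow>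
      A = (1 - of_real l) * (\<i> * C) / of_real (sqrt 2) \<and> B = 0 \<and> (char_poly k l = 0 \<or> C = 0)"
    unfolding r_def[symmetric] div cp c0[symmetric] by (simp add: L_K_c_def)
  have "symbol_kernel k l 0 1 A B C \<longleftrightarrow> (1 - L) * A = 0 \<and> (1 + K - L) * B + r * c = 0 \<and> r * B + (1 - L) * c = 0"
    unfolding symbol_kernel_def by (simp add: L_K_c_def r_def)
  also have "\<dots> \<longleftrightarrow> A = 0 \<and> r * B = - (1 - L) * c \<and> ((1 + K - L) * (1 - L) - 2 = 0 \<or> c = 0)"
  proof -
    have "r * ((1 + K - L) * B + r * c) = - ((1 + K - L) * (1 - L) - 2) * c" if "r * B = - (1 - L) * c"
      using that r(1) by algebra
    then have "(1 + K - L) * B + r * c = 0 \<longleftrightarrow> (1 + K - L) * (1 - L) - 2 = 0 \<or> c = 0" if "r * B = - (1 - L) * c"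
      using that r(2) by (metis mult_eq_0_iff neg_equal_0_iff_equal)
    moreover have "r * B + (1 - L) * c = 0 \<longleftrightarrow> r * B = - (1 - L) * c"
      by (intro iffI; algebra)
    ultimately show ?thesis using L unfolding mult_eq_0_iff by blast
  qed
  finally show "symbol_kernel k l 0 1 A B C \<longleftrightarrow>
      A = 0 \<and> B = - (1 - of_real l) * (\<i> * C) / of_real (sqrt 2) \<and> (char_poly k l = 0 \<or> C = 0)"
    unfolding r_def[symmetric] div cp c0[symmetric] by (simp add: L_K_c_def)
qed

lemma symbol_kernel_const: "symbol_kernel k l 0 0 A B C \<longleftrightarrow> l = 0 \<or> A = 0 \<and> B = 0 \<and> C = 0"
  by (auto simp: symbol_kernel_def)

section \<open>Eigensections\<close>

text \<open>
  The first factor of the parameters spans the part of the kernel that exists for every \<open>p\<close>: the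
  modes \<open>(0, 0)\<close>, \<open>(1, 1)\<close> and \<open>(1, -1)\<close>. The second one carries the modes \<open>(1, 0)\<close> and
  \<open>(0, 1)\<close>, which make up the index for \<open>p < 4\<close> and enter the kernel for \<open>p = 4\<close>.
\<close>

type_synonym parameters = "(real \<times> real \<times> real \<times> complex \<times> complex) \<times> (complex \<times> complex)"

text \<open>Of each pair of opposite frequencies one suffices, as the functions are real. On nonzero
  frequencies the tangential coefficients are those forced by the normal one through
  \<open>symbol_kernel_diagonal\<close> and \<open>symbol_kernel_axis\<close>.\<close>

definition solution :: "real \<Rightarrow> parameters \<Rightarrow> real \<times> real \<Rightarrow> real ^ 4" where
  "solution l = (\<lambda>((\<alpha>, \<beta>, \<delta>, z, w), (u, v)). comb
    (\<lambda>x. mode (of_real \<alpha>) 0 0 x + mode (\<i> * z / of_real (sqrt 2)) 1 1 x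
        + mode (\<i> * w / of_real (sqrt 2)) 1 (- 1) x + mode ((1 - of_real l) * (\<i> * u) / of_real (sqrt 2)) 1 0 x)
    (\<lambda>x. mode (of_real \<beta>) 0 0 x + mode (- (\<i> * z) / of_real (sqrt 2)) 1 1 x
        + mode (\<i> * w / of_real (sqrt 2)) 1 (- 1) x + mode (- (1 - of_real l) * (\<i> * v) / of_real (sqrt 2)) 0 1 x)
    (\<lambda>x. mode (of_real \<delta>) 0 0 x + mode z 1 1 x + mode w 1 (- 1) x + mode u 1 0 x + mode v 0 1 x))"

lemma linear_solution: "linear (solution l)"
proof (rule linearI)
  fix q r :: parameters and s :: real
  obtain \<alpha> \<beta> \<delta> z w u v where q: "q = ((\<alpha>, \<beta>, \<delta>, z, w), (u, v))"
    by (metis surj_pair)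
  obtain \<alpha>' \<beta>' \<delta>' z' w' u' v' where r: "r = ((\<alpha>', \<beta>', \<delta>', z', w'), (u', v'))"
    by (metis surj_pair)
  show "solution l (q + r) = solution l q + solution l r"
    unfolding solution_def q r add_Pair prod.case comb_algebra(1) comb_eq_iff mode_def
    by (intro conjI ext; simp add: algebra_simps add_divide_distrib diff_divide_distrib)
  show "solution l (s *\<^sub>R q) = s *\<^sub>R solution l q"
    unfolding solution_def q scaleR_Pair prod.case comb_algebra(3) comb_eq_iff mode_def
    by (intro conjI ext; simp add: algebra_simps add_divide_distrib diff_divide_distrib)
qed

lemma symbol_kernel_diagonal_zero:
  assumes "m\<^sup>2 = 1" "n\<^sup>2 = 1"
  shows "symbol_kernel k 0 m n (of_int m * c / of_real (sqrt 2)) (- of_int n * c / of_real (sqrt 2)) (- \<i> * c)"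
proof -
  define r where "r = complex_of_real (sqrt 2)"
  define M N where "M = complex_of_int m" "N = complex_of_int n"
  have r: "r * r = 2" "r \<noteq> 0"
    by (simp_all add: r_def flip: of_real_mult)
  have s: "M\<^sup>2 = 1" "N\<^sup>2 = 1"
    using assms unfolding M_N_def by (metis of_int_1 of_int_power)+
  have cancel: "r * r = 2" "r * (r * x) = 2 * x" "M * M = 1" "M * (M * x) = x" "N * N = 1" "N * (N * x) = x" for x
    using r(1) s by (simp_all add: power2_eq_square mult.assoc[symmetric])
  have e: "\<i> * (- \<i> * c) = c" by simp
  define d where "d = c / r"
  have d: "x * c / r = x * d" "c = r * d" for x using r(2) by (simp_all add: d_def)
  show ?thesis
    unfolding symbol_kernel_def e d(1) r_def[symmetric] M_N_def[symmetric] of_real_0 s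
    unfolding d(2) by (simp add: cancel algebra_simps)
qed

lemma eigensystem_solution:
  assumes "l \<le> 0" "l = 0 \<or> \<alpha> = 0 \<and> \<beta> = 0 \<and> \<delta> = 0 \<and> z = 0 \<and> w = 0"
    "char_poly k l = 0 \<or> u = 0 \<and> v = 0"
  shows "\<exists>a b c. eigensystem k l a b c \<and> solution l ((\<alpha>, \<beta>, \<delta>, z, w), (u, v)) = comb a b c"
proof -
  let ?r = "complex_of_real (sqrt 2)"
  have "symbol_kernel k l 0 0 (of_real \<alpha>) (of_real \<beta>) (of_real \<delta>)"
    using assms(2) by (auto simp: symbol_kernel_const)
  moreover have "symbol_kernel k l 1 1 (\<i> * z / ?r) (- (\<i> * z) / ?r) z"
    using symbol_kernel_diagonal_zero[of 1 1 k "\<i> * z"] assms(2) by (auto simp: symbol_kernel_def)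
  moreover have "symbol_kernel k l 1 (- 1) (\<i> * w / ?r) (\<i> * w / ?r) w"
    using symbol_kernel_diagonal_zero[of 1 "- 1" k "\<i> * w"] assms(2) by (auto simp: symbol_kernel_def)
  moreover have "symbol_kernel k l 1 0 ((1 - of_real l) * (\<i> * u) / ?r) 0 u"
    using assms(3) unfolding symbol_kernel_axis[OF assms(1)] by auto
  moreover have "symbol_kernel k l 0 1 0 (- (1 - of_real l) * (\<i> * v) / ?r) v"
    using assms(3) unfolding symbol_kernel_axis[OF assms(1)] by auto
  \<comment> \<open>The summands \<open>mode 0 0 1\<close> and \<open>mode 0 1 0\<close> are zero;
    they give every frequency a triple of coefficients so that \<open>eigensystem_add\<close>
    applies, and \<open>mode_0\<close> then removes them.\<close>
  ultimately have "eigensystem k l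
    (\<lambda>x. mode (of_real \<alpha>) 0 0 x + mode (\<i> * z / ?r) 1 1 x + mode (\<i> * w / ?r) 1 (- 1) x
        + mode ((1 - of_real l) * (\<i> * u) / ?r) 1 0 x + mode 0 0 1 x)
    (\<lambda>x. mode (of_real \<beta>) 0 0 x + mode (- (\<i> * z) / ?r) 1 1 x + mode (\<i> * w / ?r) 1 (- 1) x
        + mode 0 1 0 x + mode (- (1 - of_real l) * (\<i> * v) / ?r) 0 1 x)
    (\<lambda>x. mode (of_real \<delta>) 0 0 x + mode z 1 1 x + mode w 1 (- 1) x + mode u 1 0 x + mode v 0 1 x)"
    by (intro eigensystem_add eigensystem_mode)
  then show ?thesis
    unfolding mode_0 add_0_right solution_def prod.case by blast
qed

lemma fourier_solution:
  "fourier (\<lambda>x. mode z\<^sub>1 0 0 x + mode z\<^sub>2 1 1 x + mode z\<^sub>3 1 (- 1) x + mode z\<^sub>4 m' n' x) m n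
    = fourier (mode z\<^sub>1 0 0) m n + fourier (mode z\<^sub>2 1 1) m n + fourier (mode z\<^sub>3 1 (- 1)) m n + fourier (mode z\<^sub>4 m' n') m n"
  "fourier (\<lambda>x. mode z\<^sub>1 0 0 x + mode z\<^sub>2 1 1 x + mode z\<^sub>3 1 (- 1) x + mode z\<^sub>4 1 0 x + mode z\<^sub>5 0 1 x) m n
    = fourier (mode z\<^sub>1 0 0) m n + fourier (mode z\<^sub>2 1 1) m n + fourier (mode z\<^sub>3 1 (- 1)) m n
      + fourier (mode z\<^sub>4 1 0) m n + fourier (mode z\<^sub>5 0 1) m n"
  by (simp_all add: fourier_linear smooth_periodic_mode smooth_periodic_intros)

lemma inj_solution: "inj (solution l)"
  unfolding linear_injective_0[OF linear_solution]
proof (intro allI impI)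
  fix q assume q: "solution l q = 0"
  obtain \<alpha> \<beta> \<delta> z w u v where q_eq: "q = ((\<alpha>, \<beta>, \<delta>, z, w), (u, v))"
    by (metis surj_pair)
  have zero: "fourier (\<lambda>x. 0) m n = 0" for m n by (simp add: fourier_def)
  have "solution l q = comb (\<lambda>x. 0) (\<lambda>x. 0) (\<lambda>x. 0)"
    by (rule trans[OF q comb_algebra(4)])
  note abc = this[unfolded q_eq solution_def prod.case comb_eq_iff]
  note F = fourier_solution(1)[where m' = 1 and n' = 0] fourier_solution(2) fourier_solution(1)[where m' = 0 and n' = 1]
  have c: "fourier (mode (of_real \<delta>) 0 0) m n + fourier (mode z 1 1) m n + fourier (mode w 1 (- 1)) m n
      + fourier (mode u 1 0) m n + fourier (mode v 0 1) m n = 0" for m n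
    using arg_cong[OF conjunct2[OF conjunct2[OF abc]], of "\<lambda>f. fourier f m n"] unfolding F(2) zero .
  \<comment> \<open>Each parameter except \<alpha> and \<beta> sits at its own frequency in the
    normal component.\<close>
  have "\<delta> = 0" "z = 0" "w = 0" "u = 0" "v = 0"
    using c[of 0 0] c[of 1 1] c[of 1 "- 1"] c[of 1 0] c[of 0 1] by (simp_all add: fourier_mode)
  moreover have "\<alpha> = 0"
  proof -
    have "fourier (mode (of_real \<alpha>) 0 0) 0 0 + fourier (mode (\<i> * z / of_real (sqrt 2)) 1 1) 0 0
        + fourier (mode (\<i> * w / of_real (sqrt 2)) 1 (- 1)) 0 0
        + fourier (mode ((1 - of_real l) * (\<i> * u) / of_real (sqrt 2)) 1 0) 0 0 = 0"
      using arg_cong[OF conjunct1[OF abc], of "\<lambda>f. fourier f 0 0"] unfolding F(1) zero .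
    then show ?thesis by (simp add: fourier_mode)
  qed
  moreover have "\<beta> = 0"
  proof -
    have "fourier (mode (of_real \<beta>) 0 0) 0 0 + fourier (mode (- (\<i> * z) / of_real (sqrt 2)) 1 1) 0 0
        + fourier (mode (\<i> * w / of_real (sqrt 2)) 1 (- 1)) 0 0
        + fourier (mode (- (1 - of_real l) * (\<i> * v) / of_real (sqrt 2)) 0 1) 0 0 = 0"
      using arg_cong[OF conjunct1[OF conjunct2[OF abc]], of "\<lambda>f. fourier f 0 0"] unfolding F(3) zero .
    then show ?thesis by (simp add: fourier_mode)
  qed
  ultimately show "q = 0" by (simp add: q_eq zero_prod_def)
qed

lemma solution_of_eigensystem:
  assumes e: "eigensystem k l a b c" and k: "k \<ge> - 1 / 2" "l \<le> 0" "l < 0 \<or> k > - 1 / 2"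
  obtains \<alpha> \<beta> \<delta> z w u v where "comb a b c = solution l ((\<alpha>, \<beta>, \<delta>, z, w), (u, v))"
    "l = 0 \<or> \<alpha> = 0 \<and> \<beta> = 0 \<and> \<delta> = 0 \<and> z = 0 \<and> w = 0"
    "char_poly k l = 0 \<or> u = 0 \<and> v = 0"
proof -
  note K = eigensystem_fourier[OF e]
  have sp: "smooth_periodic a" "smooth_periodic b" "smooth_periodic c"
    using e by (auto simp: eigensystem_def)
  \<comment> \<open>By \<open>fourier_mode\<close> the coefficient of a mode is half its amplitude,
    hence the factors 2 below; the constant mode needs none.\<close>
  define \<alpha> \<beta> \<delta> where "\<alpha> = Re (fourier a 0 0)" "\<beta> = Re (fourier b 0 0)" "\<delta> = Re (fourier c 0 0)"
  define z w u v where "z = 2 * fourier c 1 1" "w = 2 * fourier c 1 (- 1)" "u = 2 * fourier c 1 0" "v = 2 * fourier c 0 1"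
  have re: "of_real (Re (fourier f 0 0)) = fourier f 0 0" for f
    using fourier_cnj[of f 0 0] by (simp add: complex_eq_iff)
  note high = symbol_kernel_high[OF K k]
  note d1 = symbol_kernel_diagonal[OF K[of 1 1] k(1,2)]
  note d2 = symbol_kernel_diagonal[OF K[of 1 "- 1"] k(1,2)]
  note a1 = K[of 1 0, unfolded symbol_kernel_axis[OF k(2)]]
  note a2 = K[of 0 1, unfolded symbol_kernel_axis[OF k(2)]]
  note cnj = fourier_cnj[of _ 1 1, simplified] fourier_cnj[of _ 1 "- 1", simplified]
    fourier_cnj[of _ 1 0, simplified] fourier_cnj[of _ 0 1, simplified] fourier_cnj[of _ 0 0, simplified, symmetric]
  note F = fourier_solution(1)[where m' = 1 and n' = 0] fourier_solution(2) fourier_solution(1)[where m' = 0 and n' = 1]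
  have low: "m \<in> {- 1, 0, 1} \<and> n \<in> {- 1, 0, 1}" if "\<not> m\<^sup>2 + n\<^sup>2 \<ge> 4" for m n :: int
  proof -
    have "m\<^sup>2 < 2\<^sup>2" "n\<^sup>2 < 2\<^sup>2"
      using that zero_le_power2[of m] zero_le_power2[of n] unfolding power2_eq_square by linarith+
    then have "\<bar>m\<bar> < 2" "\<bar>n\<bar> < 2"
      using abs_le_square_iff[of 2 m] abs_le_square_iff[of 2 n] by force+
    then show ?thesis by auto
  qed
  \<comment> \<open>This refutes the index tests of \<open>fourier_mode\<close>, since every
    frequency in \<open>solution\<close> has squared norm at most 2.\<close>
  have high': "(m = i \<and> n = j) = False" if "m\<^sup>2 + n\<^sup>2 \<ge> 4" "i\<^sup>2 + j\<^sup>2 < 4" for m n i j :: int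
    using that by auto
  have "a = (\<lambda>x. mode (of_real \<alpha>) 0 0 x + mode (\<i> * z / of_real (sqrt 2)) 1 1 x
        + mode (\<i> * w / of_real (sqrt 2)) 1 (- 1) x + mode ((1 - of_real l) * (\<i> * u) / of_real (sqrt 2)) 1 0 x)"
  proof (rule fourier_eqI[OF sp(1)], goal_cases)
    case (2 m n)
    show ?case
    proof (cases "m\<^sup>2 + n\<^sup>2 \<ge> 4")
      case True
      show ?thesis unfolding F fourier_mode high(1)[OF True] by (simp add: high'[OF True])
    next
      case False
      show ?thesis unfolding F fourier_mode
        using low[OF False] a1 a2 d1(1) d2(1) by (auto simp: \<alpha>_\<beta>_\<delta>_def z_w_u_v_def cnj re)
    qed
  qed (intro smooth_periodic_intros smooth_periodic_mode)
  moreover have "b = (\<lambda>x. mode (of_real \<beta>) 0 0 x + mode (- (\<i> * z) / of_real (sqrt 2)) 1 1 x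
        + mode (\<i> * w / of_real (sqrt 2)) 1 (- 1) x + mode (- (1 - of_real l) * (\<i> * v) / of_real (sqrt 2)) 0 1 x)"
  proof (rule fourier_eqI[OF sp(2)], goal_cases)
    case (2 m n)
    show ?case
    proof (cases "m\<^sup>2 + n\<^sup>2 \<ge> 4")
      case True
      show ?thesis unfolding F fourier_mode high(2)[OF True] by (simp add: high'[OF True])
    next
      case False
      show ?thesis unfolding F fourier_mode
        using low[OF False] a1 a2 d1(2) d2(2) by (auto simp: \<alpha>_\<beta>_\<delta>_def z_w_u_v_def cnj re)
    qed
  qed (intro smooth_periodic_intros smooth_periodic_mode)
  moreover have "c = (\<lambda>x. mode (of_real \<delta>) 0 0 x + mode z 1 1 x + mode w 1 (- 1) x + mode u 1 0 x + mode v 0 1 x)"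
  proof (rule fourier_eqI[OF sp(3)], goal_cases)
    case (2 m n)
    show ?case
    proof (cases "m\<^sup>2 + n\<^sup>2 \<ge> 4")
      case True
      show ?thesis unfolding F fourier_mode high(3)[OF True] by (simp add: high'[OF True])
    next
      case False
      show ?thesis unfolding F fourier_mode
        using low[OF False] by (auto simp: \<alpha>_\<beta>_\<delta>_def z_w_u_v_def cnj re)
    qed
  qed (intro smooth_periodic_intros smooth_periodic_mode)
  ultimately have "comb a b c = solution l ((\<alpha>, \<beta>, \<delta>, z, w), (u, v))"
    unfolding solution_def prod.case by presburger
  moreover have "l = 0 \<or> \<alpha> = 0 \<and> \<beta> = 0 \<and> \<delta> = 0 \<and> z = 0 \<and> w = 0"
    using K[of 0 0] d1(3) d2(3) k(2) unfolding symbol_kernel_const \<alpha>_\<beta>_\<delta>_def z_w_u_v_def by force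
  moreover have "char_poly k l = 0 \<or> u = 0 \<and> v = 0"
    using a1 a2 unfolding z_w_u_v_def by auto
  ultimately show thesis by (rule that)
qed

lemma eigenspace_eq_solutions:
  assumes "p \<ge> 1" "l \<le> 0" "l < 0 \<or> p > 1"
  shows "eigenspace p (4 * 2 powr ((p - 2) / 2) * l) =
    solution l ` ((if l = 0 then UNIV else {0}) \<times> (if char_poly ((p - 2) / 2) l = 0 then UNIV else {0}))"
    (is "_ = ?S")
proof (intro equalityI subsetI)
  fix V assume "V \<in> eigenspace p (4 * 2 powr ((p - 2) / 2) * l)"
  then obtain a b c where V: "V = comb a b c" "eigensystem ((p - 2) / 2) l a b c"
    unfolding eigenspace_eq by blast
  have k: "(p - 2) / 2 \<ge> - 1 / 2" "l < 0 \<or> (p - 2) / 2 > - 1 / 2"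
    using assms by (auto simp: field_simps)
  obtain \<alpha> \<beta> \<delta> z w u v where q: "comb a b c = solution l ((\<alpha>, \<beta>, \<delta>, z, w), (u, v))"
    "l = 0 \<or> \<alpha> = 0 \<and> \<beta> = 0 \<and> \<delta> = 0 \<and> z = 0 \<and> w = 0" "char_poly ((p - 2) / 2) l = 0 \<or> u = 0 \<and> v = 0"
    by (rule solution_of_eigensystem[OF V(2) k(1) assms(2) k(2)])
  show "V \<in> ?S"
    unfolding V(1) q(1) by (rule imageI) (use q(2,3) in \<open>auto simp: zero_prod_def\<close>)
next
  fix V assume "V \<in> ?S"
  then obtain q where q: "V = solution l q"
    "q \<in> (if l = 0 then UNIV else {0}) \<times> (if char_poly ((p - 2) / 2) l = 0 then UNIV else {0})"
    by blast
  obtain \<alpha> \<beta> \<delta> z w u v where q_eq: "q = ((\<alpha>, \<beta>, \<delta>, z, w), (u, v))"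
    by (metis surj_pair)
  have "l = 0 \<or> \<alpha> = 0 \<and> \<beta> = 0 \<and> \<delta> = 0 \<and> z = 0 \<and> w = 0" "char_poly ((p - 2) / 2) l = 0 \<or> u = 0 \<and> v = 0"
    using q(2) by (auto simp: q_eq zero_prod_def split: if_splits)
  from eigensystem_solution[OF assms(2) this]
  show "V \<in> eigenspace p (4 * 2 powr ((p - 2) / 2) * l)"
    unfolding eigenspace_eq q(1) q_eq by blast
qed

section \<open>Index and nullity\<close>

lemma edim_range:
  fixes f :: "'a::euclidean_space \<Rightarrow> 'b::real_vector"
  assumes "linear f" "inj f"
  shows "edim (range f) = enat DIM('a)"
proof -
  have "range f = span (f ` Basis)"
    using linear_span_image[OF assms(1), of Basis] by simp
  moreover have "dim (range f) = DIM('a)"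
    using dim_image_eq[OF assms(1), of UNIV] assms(2) by simp
  ultimately show ?thesis
    unfolding edim_def by (metis finite_Basis finite_imageI order_refl)
qed

lemma edim_zero: "edim {0::'a::real_vector} = 0"
proof -
  have "dim {0::'a} = 0" using dim_span[of "{}::'a set"] dim_eq_card_independent[OF independent_empty, where 'a = 'a] by simp
  then show ?thesis
    unfolding edim_def by (auto intro: exI[of _ "{0}"] simp: zero_enat_def span_superset)
qed

lemma solution_first: "solution l ` (UNIV \<times> {0}) = range (\<lambda>q. solution l (q, 0))"
  and solution_second: "solution l ` ({0} \<times> UNIV) = range (\<lambda>q. solution l (0, q))"
  by auto

text \<open>By injectivity, the dimensions are those of the parameter types: 3 reals and 2 complex
  numbers make 7, and 2 complex numbers make 4.\<close>

lemma edim_solutions: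
  "edim (solution l ` UNIV) = 11" "edim (solution l ` (UNIV \<times> {0})) = 7"
  "edim (solution l ` ({0} \<times> UNIV)) = 4" "edim (solution l ` ({0} \<times> {0})) = 0"
proof -
  have "linear (solution l \<circ> (\<lambda>q. (q, 0)))" "linear (solution l \<circ> (\<lambda>q. (0, q)))"
    by (rule linear_compose[OF _ linear_solution]; rule linearI; simp)+
  moreover have "inj (solution l \<circ> (\<lambda>q. (q, 0)))" "inj (solution l \<circ> (\<lambda>q. (0, q)))"
    by (rule inj_compose[OF inj_solution]; rule injI; simp)+
  ultimately show "edim (solution l ` (UNIV \<times> {0})) = 7" "edim (solution l ` ({0} \<times> UNIV)) = 4"
    unfolding solution_first solution_second using edim_range by (force simp: o_def enat_numeral)+
  show "edim (solution l ` UNIV) = 11"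
    using edim_range[OF linear_solution inj_solution] by (simp add: enat_numeral)
  have "solution l ` ({0} \<times> {0}) = {0}"
    using linear_0[OF linear_solution] by (simp add: zero_prod_def)
  then show "edim (solution l ` ({0} \<times> {0})) = 0" by (simp add: edim_zero)
qed

text \<open>At l = 0 the value of \<open>char_poly k\<close> is k - 1, which is 0 exactly for p = 4;
  then the axis modes add 4.\<close>

lemma p_nullity_eq:
  assumes "p > 1"
  shows "p_nullity p = (if p = 4 then 11 else 7)"
proof -
  have "p_nullity p = edim (eigenspace p (4 * 2 powr ((p - 2) / 2) * 0))"
    by (simp add: p_nullity_def eigenspace_def)
  also have "\<dots> = (if p = 4 then 11 else 7)"
    using assms edim_solutions[of 0]
    by (subst eigenspace_eq_solutions) (auto simp: char_poly_def)
  finally show ?thesis .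
qed

text \<open>The discriminant (2 + k)^2 - 4 (k - 1) equals k^2 + 8. The larger root is always
  positive, and the smaller one is negative exactly when (2 + k)^2 < k^2 + 8, that is k < 1.\<close>

lemma negative_root:
  assumes "- 1 / 2 \<le> k"
  shows "k \<ge> 1 \<Longrightarrow> l < 0 \<Longrightarrow> char_poly k l \<noteq> 0"
    and "k < 1 \<Longrightarrow> \<exists>l0<0. \<forall>l<0. char_poly k l = 0 \<longleftrightarrow> l = l0"
proof -
  define q where "q = sqrt (k\<^sup>2 + 8)"
  have q: "q\<^sup>2 = k\<^sup>2 + 8" "q \<ge> 0" by (simp_all add: q_def)
  have factor: "char_poly k l = (l - (2 + k - q) / 2) * (l - (2 + k + q) / 2)" for l
    using q(1) by (simp add: char_poly_def field_simps power2_eq_square) 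
  have pos: "(2 + k + q) / 2 > 0" using assms q(2) by simp
  show "char_poly k l \<noteq> 0" if "k \<ge> 1" "l < 0"
  proof -
    have "k\<^sup>2 + 8 \<le> (2 + k)\<^sup>2" using that by (simp add: power2_eq_square algebra_simps)
    then have "q \<le> 2 + k" unfolding q_def using assms by (intro real_le_lsqrt) auto
    then show ?thesis using that pos unfolding factor by auto
  qed
  show "\<exists>l0<0. \<forall>l<0. char_poly k l = 0 \<longleftrightarrow> l = l0" if "k < 1"
  proof (intro exI conjI)
    have "(2 + k)\<^sup>2 < k\<^sup>2 + 8" using that by (simp add: power2_eq_square algebra_simps)
    then have "2 + k < q" unfolding q_def by (rule real_less_rsqrt)
    then show "(2 + k - q) / 2 < 0" by simp
    show "\<forall>l<0. char_poly k l = 0 \<longleftrightarrow> l = (2 + k - q) / 2"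
      using pos unfolding factor by auto
  qed
qed

lemma edim_eigenspace_negative:
  assumes "p \<ge> 1" "\<mu> < 0"
  shows "edim (eigenspace p \<mu>) = (if char_poly ((p - 2) / 2) (\<mu> / (4 * 2 powr ((p - 2) / 2))) = 0 then 4 else 0)"
proof -
  define l where "l = \<mu> / (4 * 2 powr ((p - 2) / 2))"
  have \<mu>: "\<mu> = 4 * 2 powr ((p - 2) / 2) * l" by (simp add: l_def)
  have "l < 0" using assms(2) by (simp add: l_def divide_neg_pos)
  then show ?thesis
    unfolding l_def[symmetric] using assms(1) edim_solutions[of l]
    by (subst \<mu>, subst eigenspace_eq_solutions) auto
qed

lemma p_index_eq:
  assumes "p \<ge> 1"
  shows "p_index p = (if p < 4 then 4 else 0)"
proof (cases "p < 4")
  case True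
  then have k: "- 1 / 2 \<le> (p - 2) / 2" "(p - 2) / 2 < 1" using assms by auto
  define r where "r = 4 * 2 powr ((p - 2) / 2)"
  have r: "r > 0" by (simp add: r_def)
  obtain l0 where l0: "l0 < 0" "\<And>l. l < 0 \<Longrightarrow> char_poly ((p - 2) / 2) l = 0 \<longleftrightarrow> l = l0"
    using negative_root(2)[OF k] by blast
  have e: "edim (eigenspace p \<mu>) = (if \<mu> = r * l0 then 4 else 0)" if "\<mu> < 0" for \<mu>
  proof -
    have "\<mu> / r < 0" using that r by (simp add: divide_neg_pos)
    then have "char_poly ((p - 2) / 2) (\<mu> / r) = 0 \<longleftrightarrow> \<mu> = r * l0"
      using l0(2) r by (auto simp: field_simps)
    then show ?thesis using edim_eigenspace_negative[OF assms that] by (simp add: r_def)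
  qed
  have neg: "r * l0 < 0" using r l0(1) by (rule mult_pos_neg)
  \<comment> \<open>A finite partial sum sees only whether the single negative eigenvalue
    \<open>r * l0\<close> belongs to \<open>F\<close>, so the supremum is attained at the
    singleton.\<close>
  have s: "(\<Sum>\<mu>\<in>F. edim (eigenspace p \<mu>)) = (if r * l0 \<in> F then 4 else 0)"
    if "finite F" "F \<subseteq> {..<0}" for F
  proof -
    have "(\<Sum>\<mu>\<in>F. edim (eigenspace p \<mu>)) = (\<Sum>\<mu>\<in>F. if \<mu> = r * l0 then 4 else 0)"
      using that(2) by (intro sum.cong refl e) auto
    then show ?thesis using that(1) by simp
  qed
  have "p_index p = 4"
    unfolding p_index_def
  proof (rule antisym)
    show "(SUP F\<in>{F. finite F \<and> F \<subseteq> {..<0}}. \<Sum>\<mu>\<in>F. edim (eigenspace p \<mu>)) \<le> 4"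
      by (rule SUP_least) (auto simp: s)
    have "(\<Sum>\<mu>\<in>{r * l0}. edim (eigenspace p \<mu>)) \<le> (SUP F\<in>{F. finite F \<and> F \<subseteq> {..<0}}. \<Sum>\<mu>\<in>F. edim (eigenspace p \<mu>))"
      by (rule SUP_upper) (use neg in auto)
    then show "4 \<le> (SUP F\<in>{F. finite F \<and> F \<subseteq> {..<0}}. \<Sum>\<mu>\<in>F. edim (eigenspace p \<mu>))"
      by (simp add: e neg)
  qed
  then show ?thesis using True by simp
next
  case False
  have e: "edim (eigenspace p \<mu>) = 0" if "\<mu> < 0" for \<mu>
    using edim_eigenspace_negative[OF assms that] negative_root(1)[of "(p - 2) / 2"] False that
    by (simp add: divide_neg_pos)
  have "p_index p = 0"
    unfolding p_index_def
    by (rule antisym[OF SUP_least]) (auto intro!: sum.neutral e)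
  then show ?thesis using False by simp
qed

theorem theorem4p9:
  fixes p :: real
  assumes "p \<ge> 1"
  shows "(p < 4 \<longrightarrow> p_index p = 4) \<and>
         (p \<ge> 4 \<longrightarrow> p_index p = 0) \<and>
         (1 < p \<and> p < 4 \<longrightarrow> p_nullity p = 7) \<and>
         (p = 4 \<longrightarrow> p_nullity p = 11) \<and>
         (p > 4 \<longrightarrow> p_nullity p = 7)"
  using p_index_eq[OF assms] p_nullity_eq[of p] by auto

end
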